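(* Let $(\theta_1,\dots,\theta_n)$ with $n\ge3$ be a finite cyclic sequence of angles with $0\le\theta_i\le\pi$ for all $i$, and suppose the sequence is not a permutation of $(0,0,\pi)$. Then there is a simple arc-polygon with $n$ vertices whose interior angles, in cyclic order around the polygon, are $\theta_1,\dots,\theta_n$.
   Context: An arc-polygon is a cyclic sequence alternating between points (vertices) and closed circular arcs (edges) in the Euclidean plane, each arc appearing consecutively with its two endpoints; straight line segments count as degenerate circular arcs. It is simple if the only intersection points between pairs of its edges are shared vertices consecutive with both edges; its edges then form a Jordan curve bounding an interior. The interior angle at a vertex is the angle between the tangent lines of its two incident arcs at that vertex, measured through the interior of the polygon near the vertex. *)

theory Defs
  imports "HOL-Analysis.Analysis" "HOL-Library.Multiset"
begin

definition arc_edge :: "complex \<Rightarrow> complex \<Rightarrow> (real \<Rightarrow> complex) \<Rightarrow> bool" where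
  "arc_edge a b g \<longleftrightarrow> a \<noteq> b \<and> g 0 = a \<and> g 1 = b \<and>
     (g = linepath a b \<or>
      (\<exists>c r s t. r > 0 \<and> t \<noteq> 0 \<and> \<bar>t\<bar> < 2 * pi \<and>
                 g = (\<lambda>x. c + complex_of_real r * cis (s + t * x))))"

definition simple_arc_polygon ::
  "nat \<Rightarrow> (nat \<Rightarrow> complex) \<Rightarrow> (nat \<Rightarrow> real \<Rightarrow> complex) \<Rightarrow> bool" where
  "simple_arc_polygon n v g \<longleftrightarrow> n \<ge> 2 \<and> inj_on v {..<n} \<and>
     (\<forall>i<n. arc_edge (v i) (v (Suc i mod n)) (g i)) \<and>
     (\<forall>i<n. \<forall>j<n. i \<noteq> j \<longrightarrow>
        path_image (g i) \<inter> path_image (g j)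
          \<subseteq> {v i, v (Suc i mod n)} \<inter> {v j, v (Suc j mod n)})"

definition arc_polygon_interior :: "nat \<Rightarrow> (nat \<Rightarrow> real \<Rightarrow> complex) \<Rightarrow> complex set" where
  "arc_polygon_interior n g = inside (\<Union>i<n. path_image (g i))"

definition interior_angle ::
  "nat \<Rightarrow> (nat \<Rightarrow> complex) \<Rightarrow> (nat \<Rightarrow> real \<Rightarrow> complex) \<Rightarrow> nat \<Rightarrow> real" where
  "interior_angle n v g i =
     measure lborel {\<phi> \<in> {0..<2 * pi}. \<exists>\<epsilon>>0. \<forall>t. 0 < t \<and> t < \<epsilon> \<longrightarrow>
        v i + complex_of_real t * cis \<phi> \<in> arc_polygon_interior n g}"

end

theory Submission
  imports Defs
begin

text \<open>
  The polygon is the boundary of a region \<open>{z. A < Re z < B \<and> h (Re z) < Im z < H (Re z)}\<close> between two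
  functions whose graphs are chains of circular arcs; that this region is the inside of the curve is
  seen with vertical rays, without the Jordan curve theorem.  Over an interval, a circular arc that
  is a graph is determined by the angles \<open>l, r \<in> [-\<pi>/2, \<pi>/2]\<close> of its tangents at the two ends,
  because the sine of the tangent angle is an affine function of the abscissa, and the chord has
  angle \<open>(l + r)/2\<close>.

  Two vertices with angles \<open>p\<close> and \<open>q\<close> are joined by a single concave arc from above; the vertices with
  angle \<open>\<pi>\<close> on that side subdivide it.  At each vertex of the lower chain the exterior angle is split
  between the incoming and the outgoing tangent so that the first edge descends and the last edge ascends
  relative to the chord of the upper arc; then the lengths can be chosen such that the chain closes
  up below this chord.  After a rotation this covers everything except one angle \<open>0\<close> followed by
  angles \<open>\<pi>\<close>, realised by a yin-yang figure, and \<open>(0, \<pi>, 0, \<pi>)\<close>, realised by four semicircles.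
\<close>

subsection \<open>Circular arcs as graphs\<close>

text \<open>Closing the lower chain under the chord of the cap needs only two strict inequalities:
  the first edge must have a chord of smaller angle than the cap chord, the last edge one of larger
  angle. Every other requirement is an interval for the tangent angles. Let \<open>p\<close> and
  \<open>q\<close> be the angles at the two ends of the cap and \<mu> their mean. If the lower chain
  has a single inner vertex, of angle \<open>t\<close>, the same splitting of its exterior angle
  must serve both inequalities. This forces \<open>2 * (a - \<mu>) < pi - t\<close>, where
  \<open>a \<le> \<mu>\<close> describes the bulge of the cap; it breaks down for
  \<open>p = q = 0\<close> and \<open>t = pi\<close>. That is the origin of the excluded triple. The
  sequence (0, \<pi>, 0, \<pi>) meets the same obstruction at either choice of cap, whereas with
  five or more vertices the long run of angles \<pi> can be put on the lower chain, whose first and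
  last inner vertices are then independent. A single angle 0 among angles \<pi> fails for another
  reason: a cap from angle 0 to angle \<pi> would have a vertical chord.\<close>

text \<open>\<open>arc_dir l r \<xi>\<close> is the tangent angle at relative abscissa \<open>\<xi>\<close> of the arc with end angles \<open>l\<close>
  and \<open>r\<close>; \<open>arc_prof\<close> is the height of this arc over the unit interval.  The condition \<open>\<bar>l + r\<bar> < \<pi>\<close>
  in \<open>good_dirs\<close> excludes vertical chords.\<close>

definition arc_dir :: "real \<Rightarrow> real \<Rightarrow> real \<Rightarrow> real" where
  "arc_dir l r \<xi> = arcsin (sin l + \<xi> * (sin r - sin l))"

definition arc_prof :: "real \<Rightarrow> real \<Rightarrow> real \<Rightarrow> real" where
  "arc_prof l r \<xi> = (if l = r then \<xi> * tan l
     else (cos l - cos (arc_dir l r \<xi>)) / (sin r - sin l))"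

definition good_dirs :: "real \<Rightarrow> real \<Rightarrow> bool" where
  "good_dirs l r \<longleftrightarrow> \<bar>l\<bar> \<le> pi/2 \<and> \<bar>r\<bar> \<le> pi/2 \<and> \<bar>l + r\<bar> < pi"

text \<open>With \<open>sin\<close> of the tangent angle as abscissa and \<open>- cos\<close> as
  ordinate, this says that the chord has the mean of the two tangent angles. The product form
  survives equal sines.\<close>

lemma cos_diff_tan:
  fixes a b :: real
  assumes "\<bar>a + b\<bar> < pi"
  shows "cos a - cos b = (sin b - sin a) * tan ((a + b)/2)"
proof -
  have c: "cos ((a+b)/2) \<noteq> 0"
    using assms by (intro less_imp_neq[THEN not_sym] cos_gt_zero_pi) (auto simp: abs_less_iff)
  have 1: "cos a - cos b = 2 * sin ((a + b)/2) * sin ((b - a)/2)"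
    by (rule cos_diff_cos)
  have 2: "sin b - sin a = 2 * sin ((b - a)/2) * cos ((b + a)/2)"
    by (rule sin_diff_sin)
  show ?thesis
    unfolding 1 2 tan_def using c by (simp add: field_simps)
qed

lemma sin_inj_half_pi:
  assumes "\<bar>l\<bar> \<le> pi/2" "\<bar>r\<bar> \<le> pi/2"
  shows "sin l = sin r \<longleftrightarrow> l = (r::real)"
  using assms sin_inj_pi[of l r] by (auto simp: abs_le_iff)

lemma affine_sin_range:
  assumes "0 \<le> \<xi>" "\<xi> \<le> 1"
  shows "min (sin l) (sin r) \<le> sin l + \<xi> * (sin r - sin l)"
    "sin l + \<xi> * (sin r - sin l) \<le> max (sin l) (sin r::real)"
proof -
  have eq: "sin l + \<xi> * (sin r - sin l) = (1-\<xi>) * sin l + \<xi> * sin r" by (simp add: algebra_simps)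
  have "(1-\<xi>) * min (sin l) (sin r) + \<xi> * min (sin l) (sin r) \<le> (1-\<xi>) * sin l + \<xi> * sin r"
    using assms by (intro add_mono mult_left_mono) auto
  then show "min (sin l) (sin r) \<le> sin l + \<xi> * (sin r - sin l)"
    unfolding eq by (simp add: algebra_simps)
  have "(1-\<xi>) * sin l + \<xi> * sin r \<le> (1-\<xi>) * max (sin l) (sin r) + \<xi> * max (sin l) (sin r)"
    using assms by (intro add_mono mult_left_mono) auto
  then show "sin l + \<xi> * (sin r - sin l) \<le> max (sin l) (sin r)"
    unfolding eq by (simp add: algebra_simps)
qed

lemma affine_sin_unit:
  assumes "0 \<le> \<xi>" "\<xi> \<le> 1"
  shows "- 1 \<le> sin l + \<xi> * (sin r - sin l)" "sin l + \<xi> * (sin r - sin l) \<le> (1::real)"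
  using affine_sin_range[OF assms, of l r] sin_ge_minus_one[of l] sin_ge_minus_one[of r]
    sin_le_one[of l] sin_le_one[of r]
  unfolding min_le_iff_disj le_max_iff_disj by linarith+

lemma arc_dir_bounded:
  assumes "0 \<le> \<xi>" "\<xi> \<le> 1"
  shows "\<bar>arc_dir l r \<xi>\<bar> \<le> pi/2"
  using arcsin_bounded[OF affine_sin_unit[OF assms, of l r]] unfolding arc_dir_def by linarith

lemma sin_arc_dir:
  assumes "0 \<le> \<xi>" "\<xi> \<le> 1"
  shows "sin (arc_dir l r \<xi>) = sin l + \<xi> * (sin r - sin l)"
  unfolding arc_dir_def by (rule sin_arcsin[OF affine_sin_unit[OF assms]])

lemma arc_dir_ends [simp]:
  assumes "good_dirs l r"
  shows "arc_dir l r 0 = l" "arc_dir l r 1 = r"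
  using assms by (auto simp: arc_dir_def good_dirs_def arcsin_sin abs_le_iff)

lemma arc_dir_same: "good_dirs l l \<Longrightarrow> arc_dir l l \<xi> = l"
  using arcsin_sin[of l] unfolding arc_dir_def good_dirs_def abs_le_iff by simp

lemma continuous_on_arc_dir: "continuous_on {0..1} (arc_dir l r)"
  unfolding arc_dir_def using affine_sin_unit by (intro continuous_intros) auto

lemma arc_prof_0 [simp]: "good_dirs l r \<Longrightarrow> arc_prof l r 0 = 0"
  by (simp add: arc_prof_def)

lemma continuous_on_arc_prof:
  assumes "good_dirs l r" shows "continuous_on {0..1} (arc_prof l r)"
proof (cases "l = r")
  case True
  then show ?thesis by (auto simp: arc_prof_def fun_eq_iff intro!: continuous_intros)
next
  case False
  then have "sin r - sin l \<noteq> 0"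
    using assms sin_inj_half_pi[of l r] by (auto simp: good_dirs_def)
  with False show ?thesis
    unfolding arc_prof_def by (auto intro!: continuous_intros continuous_on_arc_dir)
qed

lemma sin_mono_iff:
  assumes "\<bar>l\<bar> \<le> pi/2" "\<bar>r\<bar> \<le> pi/2"
  shows "sin l \<le> sin r \<longleftrightarrow> l \<le> (r::real)" "sin l < sin r \<longleftrightarrow> l < (r::real)"
  using assms by (auto simp: abs_le_iff sin_mono_le_eq sin_mono_less_eq)

lemma arc_dir_le:
  assumes "good_dirs l r" "0 \<le> \<xi>" "\<xi> \<le> 1"
  shows "arc_dir l r \<xi> \<le> max l r" "min l r \<le> arc_dir l r \<xi>"
proof -
  note b = arc_dir_bounded[OF assms(2,3), of l r]
  have lr: "\<bar>l\<bar> \<le> pi/2" "\<bar>r\<bar> \<le> pi/2" using assms by (auto simp: good_dirs_def)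
  show "arc_dir l r \<xi> \<le> max l r"
    using affine_sin_range(2)[OF assms(2,3), of l r] sin_mono_iff[OF b lr(1)] sin_mono_iff[OF b lr(2)]
    unfolding sin_arc_dir[OF assms(2,3)] le_max_iff_disj by blast
  show "min l r \<le> arc_dir l r \<xi>"
    using affine_sin_range(1)[OF assms(2,3), of l r] sin_mono_iff[OF lr(1) b] sin_mono_iff[OF lr(2) b]
    unfolding sin_arc_dir[OF assms(2,3)] min_le_iff_disj by blast
qed

lemma arc_dir_less_l:
  assumes "good_dirs l r" "0 < \<xi>" "\<xi> \<le> 1" 
  shows "r < l \<Longrightarrow> arc_dir l r \<xi> < l" "l < r \<Longrightarrow> l < arc_dir l r \<xi>"
proof -
  note b = arc_dir_bounded[of \<xi> l r]
  have lr: "\<bar>l\<bar> \<le> pi/2" "\<bar>r\<bar> \<le> pi/2" using assms by (auto simp: good_dirs_def)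
  show "r < l \<Longrightarrow> arc_dir l r \<xi> < l"
    using assms sin_mono_iff(2)[OF lr(2,1)] sin_mono_iff(2)[OF b lr(1)] sin_arc_dir[of \<xi> l r]
    by (auto simp: mult_less_0_iff)
  show "l < r \<Longrightarrow> l < arc_dir l r \<xi>"
    using assms sin_mono_iff(2)[OF lr(1,2)] sin_mono_iff(2)[OF lr(1) b] sin_arc_dir[of \<xi> l r]
    by (auto simp: mult_less_0_iff)
qed

lemma arc_dir_swap: "arc_dir l r (1 - \<xi>) = arc_dir r l \<xi>"
  by (simp add: arc_dir_def algebra_simps)

lemma good_dirs_swap: "good_dirs l r \<Longrightarrow> good_dirs r l"
  by (auto simp: good_dirs_def add.commute)

text \<open>A sum \<pi> or -\<pi> would need both directions to be the same vertical one. For \<xi>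
  > 0 the tangent angle has moved strictly away from \<open>l\<close> unless the arc is straight,
  and a straight arc is not vertical.\<close>

lemma arc_dir_sum_l:
  assumes "good_dirs l r" "0 < \<xi>" "\<xi> \<le> 1" 
  shows "\<bar>l + arc_dir l r \<xi>\<bar> < pi"
proof -
  have lr: "\<bar>l\<bar> \<le> pi/2" "\<bar>r\<bar> \<le> pi/2" "\<bar>l + r\<bar> < pi" using assms by (auto simp: good_dirs_def)
  have "l \<le> arc_dir l r \<xi> \<and> arc_dir l r \<xi> \<le> r \<and> l \<le> r \<and> (l < r \<longrightarrow> l < arc_dir l r \<xi>) \<or> 
     r \<le> arc_dir l r \<xi> \<and> arc_dir l r \<xi> \<le> l \<and> r \<le> l \<and> (r < l \<longrightarrow> arc_dir l r \<xi> < l)"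
    using arc_dir_le[of l r \<xi>] arc_dir_less_l[of l r \<xi>] assms by (auto simp: min_def max_def split: if_splits)
  then show ?thesis using lr by (auto simp: abs_less_iff abs_le_iff)
qed

lemma arc_dir_sum_r:
  assumes "good_dirs l r" "0 \<le> \<xi>" "\<xi> < 1" 
  shows "\<bar>r + arc_dir l r \<xi>\<bar> < pi"
  using arc_dir_sum_l[OF good_dirs_swap[OF assms(1)], of "1-\<xi>"] assms(2,3) by (simp add: arc_dir_swap)

text \<open>An initial piece of the arc is again an arc, so its chord has the mean of its own end
  angles. This form treats segments and circles alike; all comparisons of slopes start from
  it.\<close>

lemma arc_prof_left:
  assumes "good_dirs l r" "0 < \<xi>" "\<xi> \<le> 1"
  shows "arc_prof l r \<xi> = \<xi> * tan ((l + arc_dir l r \<xi>)/2)"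
proof (cases "l = r")
  case True
  then show ?thesis using assms by (simp add: arc_prof_def arc_dir_same)
next
  case False
  then have "sin r - sin l \<noteq> 0"
    using assms sin_inj_half_pi[of l r] by (auto simp: good_dirs_def)
  with False show ?thesis
    using cos_diff_tan[OF arc_dir_sum_l[OF assms]] assms sin_arc_dir[of \<xi> l r]
    by (simp add: arc_prof_def)
qed

lemma arc_prof_1: "good_dirs l r \<Longrightarrow> arc_prof l r 1 = tan ((l + r)/2)"
  using arc_prof_left[of l r 1] by simp

lemma arc_prof_right:
  assumes "good_dirs l r" "0 \<le> \<xi>" "\<xi> < 1"
  shows "arc_prof l r \<xi> = arc_prof l r 1 - (1 - \<xi>) * tan ((r + arc_dir l r \<xi>)/2)"
proof (cases "l = r")
  case True
  then show ?thesis using assms by (simp add: arc_prof_def arc_dir_same algebra_simps)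
next
  case False
  then have ne: "sin r - sin l \<noteq> 0"
    using assms sin_inj_half_pi[of l r] by (auto simp: good_dirs_def)
  have "cos (arc_dir l r \<xi>) = cos r - (sin (arc_dir l r \<xi>) - sin r) * tan ((r + arc_dir l r \<xi>)/2)"
    using cos_diff_tan[OF arc_dir_sum_r[OF assms]] by simp
  also have "sin (arc_dir l r \<xi>) - sin r = - (1 - \<xi>) * (sin r - sin l)"
    using sin_arc_dir[of \<xi> l r] assms by (simp add: algebra_simps)
  finally show ?thesis using False ne assms
    by (simp add: arc_prof_def field_simps)
qed

section \<open>Arcs over an arbitrary interval, as graphs and as paths\<close>

definition arc_fun :: "real \<Rightarrow> real \<Rightarrow> real \<Rightarrow> real \<Rightarrow> real \<Rightarrow> real \<Rightarrow> real" where
  "arc_fun x0 x1 y0 l r t = y0 + (x1 - x0) * arc_prof l r ((t - x0) / (x1 - x0))"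

text \<open>A circular arc is parametrised by its tangent angle \<open>l + (r - l) * u\<close>. The
  number \<rho> is a signed radius, positive exactly for arcs that bend upwards, so that the
  abscissa increases in both cases.\<close>

definition arc_path :: "real \<Rightarrow> real \<Rightarrow> real \<Rightarrow> real \<Rightarrow> real \<Rightarrow> real \<Rightarrow> complex" where
  "arc_path x0 x1 y0 l r = (if l = r then linepath (Complex x0 y0) (Complex x1 (arc_fun x0 x1 y0 l r x1))
    else let \<rho> = (x1 - x0) / (sin r - sin l) in
     (\<lambda>u. Complex (x0 + \<rho> * (sin (l + (r - l) * u) - sin l)) (y0 + \<rho> * (cos l - cos (l + (r - l) * u)))))"

lemma arc_path_arc_edge:
  assumes g: "good_dirs l r" and x: "x0 < x1"
  shows "arc_edge (Complex x0 y0) (Complex x1 (arc_fun x0 x1 y0 l r x1)) (arc_path x0 x1 y0 l r)"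
proof (cases "l = r")
  case True
  then show ?thesis using x by (auto simp: arc_edge_def arc_path_def linepath_def)
next
  case False
  then have ne: "sin r - sin l \<noteq> 0"
    using g sin_inj_half_pi[of l r] by (auto simp: good_dirs_def)
  have lr: "\<bar>l\<bar> \<le> pi/2" "\<bar>r\<bar> \<le> pi/2" "\<bar>l + r\<bar> < pi" using g by (auto simp: good_dirs_def)
  define \<rho> where "\<rho> = (x1 - x0) / (sin r - sin l)"
  have \<rho>0: "\<rho> \<noteq> 0" using x ne by (auto simp: \<rho>_def)
  define c where "c = Complex (x0 - \<rho> * sin l) (y0 + \<rho> * cos l)"
  \<comment> \<open>On a circle the polar angle and the tangent angle differ by a quarter turn,
    whose sign depends on the sense of rotation.\<close>
  define s where "s = l - sgn \<rho> * (pi/2)"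
  have p: "arc_path x0 x1 y0 l r = (\<lambda>u. c + complex_of_real \<bar>\<rho>\<bar> * cis (s + (r - l) * u))"
  proof
    fix u
    have eq: "s + (r - l) * u = (l + (r - l) * u) - sgn \<rho> * (pi/2)" by (simp add: s_def)
    show "arc_path x0 x1 y0 l r u = c + complex_of_real \<bar>\<rho>\<bar> * cis (s + (r - l) * u)"
      unfolding eq using False \<rho>0
      by (cases "\<rho> > 0")
        (auto simp: arc_path_def complex_eq_iff c_def Let_def \<rho>_def[symmetric] cos_diff sin_diff cos_add sin_add algebra_simps)
  qed
  have "arc_path x0 x1 y0 l r 0 = Complex x0 y0" using False
    by (simp add: arc_path_def Let_def)
  moreover have "arc_path x0 x1 y0 l r 1 = Complex x1 (arc_fun x0 x1 y0 l r x1)"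
    using False x ne g
    by (simp add: arc_path_def Let_def arc_fun_def arc_prof_def)
  moreover have "\<bar>r - l\<bar> < 2 * pi" using lr pi_gt_zero by (auto simp: abs_le_iff abs_less_iff)
  moreover have "\<exists>c \<rho> s t. \<rho> > 0 \<and> t \<noteq> 0 \<and> \<bar>t\<bar> < 2 * pi \<and>
      arc_path x0 x1 y0 l r = (\<lambda>u. c + complex_of_real \<rho> * cis (s + t * u))"
    using calculation(3) p \<rho>0 False
    by (intro exI[of _ c] exI[of _ "\<bar>\<rho>\<bar>"] exI[of _ s] exI[of _ "r-l"]) simp
  ultimately show ?thesis using x
    unfolding arc_edge_def by auto
qed

lemma arc_path_image:
  assumes g: "good_dirs l r" and x: "x0 < x1"
  shows "path_image (arc_path x0 x1 y0 l r) = (\<lambda>t. Complex t (arc_fun x0 x1 y0 l r t)) ` {x0..x1}"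
proof (cases "l = r")
  case True
  have "path_image (arc_path x0 x1 y0 l r) = (\<lambda>u. Complex (x0 + u * (x1-x0)) (y0 + (x1 - x0) * (u * tan l))) ` {0..1}"
    unfolding path_image_def using True x
    by (intro image_cong) (auto simp: arc_path_def linepath_def arc_fun_def arc_prof_def complex_eq_iff algebra_simps)
  also have "\<dots> = (\<lambda>t. Complex t (arc_fun x0 x1 y0 l r t)) ` ((\<lambda>u. x0 + u * (x1-x0)) ` {0..1})"
    unfolding image_image using True x by (intro image_cong) (auto simp: arc_fun_def arc_prof_def)
  also have "(\<lambda>u. x0 + u * (x1-x0)) ` {0..1} = {x0..x1}"
    using x image_affinity_atLeastAtMost[of "x1-x0" x0 0 1] by (simp add: mult.commute add.commute)
  finally show ?thesis .
next
  case False
  then have ne: "sin r - sin l \<noteq> 0"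
    using g sin_inj_half_pi[of l r] by (auto simp: good_dirs_def)
  have lr: "\<bar>l\<bar> \<le> pi/2" "\<bar>r\<bar> \<le> pi/2" "\<bar>l + r\<bar> < pi" using g by (auto simp: good_dirs_def)
  define \<rho> where "\<rho> = (x1 - x0) / (sin r - sin l)"
  have P: "arc_path x0 x1 y0 l r u =  Complex (x0 + \<rho> * (sin (l + (r - l) * u) - sin l)) (y0 + \<rho> * (cos l - cos (l + (r - l) * u)))" for u
    using False by (simp add: arc_path_def \<rho>_def)
  have F: "arc_fun x0 x1 y0 l r (x0 + \<xi> * (x1 - x0)) = y0 + \<rho> * (cos l - cos (arc_dir l r \<xi>))" for \<xi>
    using False x ne by (simp add: arc_fun_def arc_prof_def \<rho>_def)
  have X: "x0 + \<xi> * (x1 - x0) = x0 + \<rho> * (sin (arc_dir l r \<xi>) - sin l)" if "0 \<le> \<xi>" "\<xi> \<le> 1" for \<xi>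
    using ne by (simp add: sin_arc_dir[OF that] \<rho>_def)
  have I: "(\<lambda>u. x0 + u * (x1-x0)) ` {0..1} = {x0..x1}"
    using x image_affinity_atLeastAtMost[of "x1-x0" x0 0 1] by (simp add: mult.commute add.commute)
  show ?thesis
  proof (intro equalityI subsetI)
    fix z assume "z \<in> path_image (arc_path x0 x1 y0 l r)"
    then obtain u where u: "0 \<le> u" "u \<le> 1" "z = arc_path x0 x1 y0 l r u" by (auto simp: path_image_def)
    define d where "d = l + (r - l) * u"
    have d2: "d = (1-u)*l + u * r" by (simp add: d_def algebra_simps)
    have dm: "d \<le> max l r" "min l r \<le> d"
    proof -
      have "d \<le> (1-u) * max l r + u * max l r" unfolding d2 using u by (intro add_mono mult_left_mono) auto
      then show "d \<le> max l r" by (simp add: algebra_simps)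
      have "d \<ge> (1-u) * min l r + u * min l r" unfolding d2 using u by (intro add_mono mult_left_mono) auto
      then show "min l r \<le> d" by (simp add: algebra_simps)
    qed
    have db: "\<bar>d\<bar> \<le> pi/2" using dm lr by (auto simp: max_def min_def abs_le_iff split: if_splits)
    \<comment> \<open>The relative abscissa at which the tangent angle equals \<open>d\<close>,
      found by inverting the affine law for its sine.\<close>
    define \<xi> where "\<xi> = (sin d - sin l) / (sin r - sin l)"
    have \<xi>: "0 \<le> \<xi>" "\<xi> \<le> 1"
    proof -
      have "sin l \<le> sin d \<and> sin d \<le> sin r \<or> sin r \<le> sin d \<and> sin d \<le> sin l"
        using dm sin_mono_iff(1)[OF db lr(1)] sin_mono_iff(1)[OF db lr(2)]
          sin_mono_iff(1)[OF lr(1) db] sin_mono_iff(1)[OF lr(2) db] by (auto simp: max_def min_def split: if_splits)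
      then show "0 \<le> \<xi>" "\<xi> \<le> 1" using ne unfolding \<xi>_def
        by (auto simp: divide_simps)
    qed
    have "sin (arc_dir l r \<xi>) = sin d" using sin_arc_dir[OF \<xi>, of l r] ne by (simp add: \<xi>_def)
    then have "arc_dir l r \<xi> = d" using sin_inj_half_pi[OF arc_dir_bounded[OF \<xi>] db] by simp
    then have "z = Complex (x0 + \<xi> * (x1 - x0)) (arc_fun x0 x1 y0 l r (x0 + \<xi> * (x1 - x0)))"
      unfolding u(3) P F d_def[symmetric] using X[OF \<xi>] by simp
    moreover have "x0 + \<xi> * (x1 - x0) \<in> {x0..x1}"
      unfolding I[symmetric] using \<xi> by (intro image_eqI[of _ _ \<xi>]) auto
    ultimately show "z \<in> (\<lambda>t. Complex t (arc_fun x0 x1 y0 l r t)) ` {x0..x1}"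
      by (rule image_eqI)
  next
    fix z assume "z \<in> (\<lambda>t. Complex t (arc_fun x0 x1 y0 l r t)) ` {x0..x1}"
    then obtain \<xi> where \<xi>: "0 \<le> \<xi>" "\<xi> \<le> 1" 
      "z = Complex (x0 + \<xi> * (x1 - x0)) (arc_fun x0 x1 y0 l r (x0 + \<xi> * (x1 - x0)))"
      unfolding I[symmetric] by auto
    define d where "d = arc_dir l r \<xi>"
    define u where "u = (d - l) / (r - l)"
    have "min l r \<le> d" "d \<le> max l r" using arc_dir_le[OF g \<xi>(1,2)] by (auto simp: d_def)
    then have u: "0 \<le> u" "u \<le> 1" using False unfolding u_def
      by (auto simp: divide_simps max_def min_def split: if_splits)
    have "l + (r - l) * u = d" using False by (simp add: u_def)
    then have "z = arc_path x0 x1 y0 l r u"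
      unfolding P \<xi>(3) F using X[OF \<xi>(1,2)] by (simp add: d_def)
    then show "z \<in> path_image (arc_path x0 x1 y0 l r)" using u by (auto simp: path_image_def)
  qed
qed


subsection \<open>The region between two graphs\<close>

text \<open>The component contains the whole vertical ray. The sign of \<open>s\<close> chooses
  between going up and going down.\<close>

lemma unbounded_component_ray:
  fixes z :: complex and s :: real
  assumes s: "s \<noteq> 0" and sub: "\<And>t. t \<ge> 0 \<Longrightarrow> Complex (Re z) (Im z + s * t) \<notin> K"
  shows "\<not> bounded (connected_component_set (- K) z)"
proof
  assume bd: "bounded (connected_component_set (- K) z)"
  define R where "R = (\<lambda>t. Complex (Re z) (Im z + s * t)) ` {0..}"
  have R': "R = (\<lambda>t. z + complex_of_real t * (complex_of_real s * \<i>)) ` {0..}"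
    unfolding R_def by (intro image_cong) (auto simp: complex_eq_iff)
  have "connected R" unfolding R'
    by (intro connected_continuous_image continuous_intros) auto
  moreover have "z \<in> R" unfolding R_def by (intro image_eqI[of _ _ 0]) auto
  moreover have "R \<subseteq> - K" using sub by (auto simp: R_def)
  ultimately have "R \<subseteq> connected_component_set (- K) z" by (intro connected_component_maximal)
  then have "bounded R" using bd bounded_subset by blast
  then obtain b where b: "\<And>w. w \<in> R \<Longrightarrow> norm w \<le> b" by (auto simp: bounded_iff)
  have b0: "0 \<le> b" using b[OF \<open>z \<in> R\<close>] norm_ge_zero order_trans by blast
  define t where "t = (b + 1 + \<bar>Im z\<bar>) / \<bar>s\<bar>"
  have t0: "t \<ge> 0" using b0 by (simp add: t_def)
  have "norm (Complex (Re z) (Im z + s * t)) \<le> b" using t0 by (intro b) (auto simp: R_def)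
  then have "\<bar>Im z + s * t\<bar> \<le> b" using abs_Im_le_cmod[of "Complex (Re z) (Im z + s * t)"] by simp
  moreover have "\<bar>s * t\<bar> = b + 1 + \<bar>Im z\<bar>" using s t0 b0 by (simp add: t_def abs_mult)
  ultimately show False by linarith
qed

definition graph_region :: "real \<Rightarrow> real \<Rightarrow> (real \<Rightarrow> real) \<Rightarrow> (real \<Rightarrow> real) \<Rightarrow> complex set" where
  "graph_region A B h H = {z. A < Re z \<and> Re z < B \<and> h (Re z) < Im z \<and> Im z < H (Re z)}"

text \<open>The complement of the curve is covered by two disjoint open sets, the open region and
  the complement of its closed version \<open>C\<close>. A component that meets the region therefore
  stays in the bounded set \<open>C\<close>, and every other point escapes along a vertical
  ray.\<close>

lemma inside_between_graphs:
  assumes h: "continuous_on {A..B} h" and H: "continuous_on {A..B} H"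
    and eq: "h A = H A" "h B = H B" and less: "\<And>t. A < t \<Longrightarrow> t < B \<Longrightarrow> h t < H t"
  shows "inside ((\<lambda>t. Complex t (h t)) ` {A..B} \<union> (\<lambda>t. Complex t (H t)) ` {A..B}) = graph_region A B h H"
    (is "inside ?K = ?U")
proof -
  define S where "S = {z. A \<le> Re z \<and> Re z \<le> B}"
  define C where "C = {z \<in> S. h (Re z) \<le> Im z \<and> Im z \<le> H (Re z)}"
  have Sc: "closed S" unfolding S_def
    by (intro closed_Collect_conj closed_Collect_le continuous_intros)
  have cS: "continuous_on S (\<lambda>z. Im z - h (Re z))" "continuous_on S (\<lambda>z. H (Re z) - Im z)"
    by (auto simp: S_def intro!: continuous_intros continuous_on_compose2[OF h] continuous_on_compose2[OF H])
  have "C = (S \<inter> (\<lambda>z. Im z - h (Re z)) -` {0..}) \<inter> (S \<inter> (\<lambda>z. H (Re z) - Im z) -` {0..})"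
    by (auto simp: C_def)
  then have Cc: "closed C"
    using continuous_closed_preimage[OF cS(1) Sc, of "{0..}"] continuous_closed_preimage[OF cS(2) Sc, of "{0..}"]
    by auto
  define S' where "S' = {z. A < Re z \<and> Re z < B}"
  have So: "open S'" unfolding S'_def
    by (intro open_Collect_conj open_Collect_less continuous_intros)
  have SS: "S' \<subseteq> S" by (auto simp: S_def S'_def)
  have "?U = (S' \<inter> (\<lambda>z. Im z - h (Re z)) -` {0<..}) \<inter> (S' \<inter> (\<lambda>z. H (Re z) - Im z) -` {0<..})"
    by (auto simp: S'_def graph_region_def)
  then have Uo: "open ?U"
    using continuous_open_preimage[OF continuous_on_subset[OF cS(1) SS] So, of "{0<..}"]
      continuous_open_preimage[OF continuous_on_subset[OF cS(2) SS] So, of "{0<..}"] by auto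
  have UC: "?U \<subseteq> C" by (auto simp: C_def S_def graph_region_def)
  \<comment> \<open>Over an end point the graphs meet, so \<open>C\<close> has only a point of the
    curve there; elsewhere a point of \<open>C\<close> off the curve satisfies both inequalities
    strictly.\<close>
  have split: "- ?K \<subseteq> ?U \<union> - C"
  proof
    fix z assume z: "z \<in> - ?K"
    have ne: "Im z \<noteq> h (Re z)" "Im z \<noteq> H (Re z)" if "A \<le> Re z" "Re z \<le> B"
    proof -
      have "Complex (Re z) (h (Re z)) \<in> ?K" "Complex (Re z) (H (Re z)) \<in> ?K" using that by auto
      then show "Im z \<noteq> h (Re z)" "Im z \<noteq> H (Re z)" using z by (metis ComplI Compl_iff complex_surj)+
    qed
    show "z \<in> ?U \<union> - C"
      using ne less[of "Re z"] eq by (cases "Re z = A \<or> Re z = B") (auto simp: C_def S_def graph_region_def)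
  qed
  have UK: "?U \<inter> ?K = {}" by (auto simp: graph_region_def)
  obtain m where m: "\<And>t. t \<in> {A..B} \<Longrightarrow> \<bar>h t\<bar> \<le> m \<and> \<bar>H t\<bar> \<le> m"
  proof -
    have "bounded (h ` {A..B} \<union> H ` {A..B})"
      using compact_continuous_image[OF h] compact_continuous_image[OF H] compact_imp_bounded by auto
    then obtain m where "\<forall>y\<in>h ` {A..B} \<union> H ` {A..B}. norm y \<le> m" by (auto simp: bounded_iff)
    then show ?thesis using that[of m] by auto
  qed
  have "C \<subseteq> cbox (Complex A (-m)) (Complex B m)"
    using m by (force simp: C_def S_def in_cbox_complex_iff abs_le_iff)
  then have bC: "bounded C" using bounded_cbox bounded_subset by blast
  show ?thesis
  proof (intro equalityI subsetI)
    fix z assume z: "z \<in> ?U"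
    let ?c = "connected_component_set (- ?K) z"
    have zK: "z \<in> - ?K" using z UK by blast
    have "?c \<subseteq> ?U \<union> - C" using split connected_component_subset[of "-?K" z] by blast
    then have "?U \<inter> ?c = {} \<or> - C \<inter> ?c = {}"
      using connectedD[of ?c ?U "-C"] Uo Cc UC by (auto simp: open_Compl connected_connected_component)
    moreover have "z \<in> ?U \<inter> ?c" using z zK by (auto simp: connected_component_refl)
    ultimately have "?c \<subseteq> C" by auto
    then show "z \<in> inside ?K" using zK bounded_subset[OF bC] by (auto simp: inside_def)
  next
    fix z assume z: "z \<in> inside ?K"
    then have zK: "z \<in> - ?K" and b: "bounded (connected_component_set (- ?K) z)"
      by (auto simp: inside_def)
    show "z \<in> ?U"
    proof (rule ccontr)
      assume "z \<notin> ?U"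
      then have zC: "z \<notin> C" using split zK by auto
      have case_split: "(Re z < A \<or> Re z > B) \<or> (A \<le> Re z \<and> Re z \<le> B \<and> Im z < h (Re z)) \<or>
        (A \<le> Re z \<and> Re z \<le> B \<and> Im z > H (Re z))"
        using zC by (auto simp: C_def S_def)
      consider "Re z < A \<or> Re z > B" | "A \<le> Re z" "Re z \<le> B" "Im z < h (Re z)" | 
        "A \<le> Re z" "Re z \<le> B" "Im z > H (Re z)"
        using case_split by blast
      then show False
      proof cases
        case 1
        have "Complex (Re z) (Im z + (1) * t) \<notin> ?K" if "t \<ge> 0" for t using 1 that by auto
        then show ?thesis using b unbounded_component_ray[of "1" z ?K] by force
      next
        case 2
        have le: "h (Re z) \<le> H (Re z)" using 2 eq less[of "Re z"] by (cases "Re z = A \<or> Re z = B") auto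
        have "Complex (Re z) (Im z + (-1) * t) \<notin> ?K" if "t \<ge> 0" for t using 2 le that by auto
        then show ?thesis using b unbounded_component_ray[of "-1" z ?K] by force
      next
        case 3
        have le: "h (Re z) \<le> H (Re z)" using 3 eq less[of "Re z"] by (cases "Re z = A \<or> Re z = B") auto
        have "Complex (Re z) (Im z + (1) * t) \<notin> ?K" if "t \<ge> 0" for t using 3 le that by auto
        then show ?thesis using b unbounded_component_ray[of "1" z ?K] by force
      qed
    qed
  qed
qed

subsection \<open>Measure of a set of directions\<close>

text \<open>Measurability of \<open>S\<close> comes for free, since \<open>S\<close> differs from
  the Borel set \<open>T\<close> by finitely many points. Directions tangent to an edge can thus be
  left undecided.\<close>

lemma measure_eq_modulo_finite:
  fixes S T F :: "real set"
  assumes F: "finite F" and T: "T \<in> sets borel" and "S - F = T - F"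
  shows "measure lborel S = measure lborel T"
proof -
  have "S = (T - F) \<union> (S \<inter> F)" using assms(3) by blast
  moreover have "(T - F) \<union> (S \<inter> F) \<in> sets borel"
    using F T by (intro sets.Un sets.Diff) (auto intro: borel_closed finite_imp_closed finite_Int)
  ultimately have S: "S \<in> sets borel" by simp
  have F0: "F \<in> null_sets lborel" using F by (rule finite_imp_null_set_lborel)
  have "emeasure lborel S = emeasure lborel (S \<union> F)"
    using emeasure_Un_null_set[of S lborel F] S F0 by simp
  also have "S \<union> F = T \<union> F" using assms(3) by blast
  also have "emeasure lborel \<dots> = emeasure lborel T"
    using emeasure_Un_null_set[of T lborel F] T F0 by simp
  finally show ?thesis by (simp add: measure_def)
qed

text \<open>The interval of directions may stick out of the window \<open>{0..<2 * pi}\<close>; by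
  periodicity the overhang reappears at the lower end of the window, disjoint from the rest.\<close>

lemma measure_periodic_arc_nonneg:
  fixes P :: "real \<Rightarrow> bool"
  assumes per: "\<And>\<phi>. P (\<phi> + 2 * pi) = P \<phi>"
    and \<alpha>: "0 \<le> \<alpha>" "\<alpha> \<le> 2 * pi" and \<beta>: "\<alpha> \<le> \<beta>" "\<beta> \<le> \<alpha> + 2 * pi" and E: "finite E"
    and yes: "\<And>\<phi>. \<alpha> < \<phi> \<Longrightarrow> \<phi> < \<beta> \<Longrightarrow> \<phi> \<notin> E \<Longrightarrow> P \<phi>"
    and no: "\<And>\<phi>. \<beta> < \<phi> \<Longrightarrow> \<phi> < \<alpha> + 2 * pi \<Longrightarrow> \<phi> \<notin> E \<Longrightarrow> \<not> P \<phi>"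
  shows "measure lborel {\<phi> \<in> {0..<2 * pi}. P \<phi>} = \<beta> - \<alpha>"
proof -
  \<comment> \<open>The shifted copy of \<open>E\<close> is included because for
    \<open>\<phi> < \<alpha>\<close> the hypotheses are applied at
    \<open>\<phi> + 2 * pi\<close>.\<close>
  define F where "F = E \<union> (\<lambda>e. e - 2 * pi) ` E \<union> {0, 2*pi, \<alpha>, \<beta>, \<beta> - 2 * pi}"
  have F: "finite F" using E by (simp add: F_def)
  have notF: "\<phi> + 2 * pi \<notin> E" if "\<phi> \<notin> F" for \<phi>
    using that by (auto simp: F_def image_iff)
  have key: "P \<phi> \<longleftrightarrow> (\<alpha> < \<phi> \<and> \<phi> < \<beta>) \<or> \<phi> < \<beta> - 2 * pi" if "0 \<le> \<phi>" "\<phi> < 2 * pi" "\<phi> \<notin> F" for \<phi>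
  proof (cases "\<phi> < \<alpha>")
    case True
    have "P \<phi> = P (\<phi> + 2 * pi)" by (simp add: per)
    also have "\<dots> \<longleftrightarrow> \<phi> < \<beta> - 2 * pi"
      using yes[of "\<phi> + 2*pi"] no[of "\<phi> + 2*pi"] notF[OF that(3)] True that \<alpha> \<beta> by (auto simp: F_def)
    finally show ?thesis using True by auto
  next
    case False
    then have "\<alpha> < \<phi>" using that by (auto simp: F_def)
    then show ?thesis using yes[of \<phi>] no[of \<phi>] that \<alpha> \<beta> by (auto simp: F_def)
  qed
  show ?thesis
  proof (cases "\<beta> \<le> 2 * pi")
    case True
    have "measure lborel {\<phi> \<in> {0..<2 * pi}. P \<phi>} = measure lborel {\<alpha>..\<beta>}"
      using key True \<alpha> \<beta> by (intro measure_eq_modulo_finite[OF F]) (auto simp: F_def)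
    then show ?thesis using \<beta> by simp
  next
    case False
    have "measure lborel {\<phi> \<in> {0..<2 * pi}. P \<phi>} = measure lborel ({0..<\<beta> - 2 * pi} \<union> {\<alpha><..2 * pi})"
      using key False \<alpha> \<beta> by (intro measure_eq_modulo_finite[OF F]) (auto simp: F_def)
    also have "\<dots> = measure lborel {0..<\<beta> - 2 * pi} + measure lborel {\<alpha><..2 * pi}"
      using \<beta> using \<alpha> \<beta> False by (intro measure_Union) auto
    finally show ?thesis using \<alpha> \<beta> False by simp
  qed
qed

lemma measure_periodic_arc:
  fixes P :: "real \<Rightarrow> bool"
  assumes per: "\<And>\<phi>. P (\<phi> + 2 * pi) = P \<phi>"
    and \<alpha>: "- 2 * pi \<le> \<alpha>" "\<alpha> \<le> 2 * pi" and \<beta>: "\<alpha> \<le> \<beta>" "\<beta> \<le> \<alpha> + 2 * pi" and E: "finite E"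
    and yes: "\<And>\<phi>. \<alpha> < \<phi> \<Longrightarrow> \<phi> < \<beta> \<Longrightarrow> \<phi> \<notin> E \<Longrightarrow> P \<phi>"
    and no: "\<And>\<phi>. \<beta> < \<phi> \<Longrightarrow> \<phi> < \<alpha> + 2 * pi \<Longrightarrow> \<phi> \<notin> E \<Longrightarrow> \<not> P \<phi>"
  shows "measure lborel {\<phi> \<in> {0..<2 * pi}. P \<phi>} = \<beta> - \<alpha>"
proof (cases "0 \<le> \<alpha>")
  case True
  then show ?thesis by (intro measure_periodic_arc_nonneg[where P = P and E = E]) (use assms in auto)
next
  case False
  define E' where "E' = (\<lambda>e. e + 2 * pi) ` E"
  have E': "\<phi> - 2 * pi \<notin> E" if "\<phi> \<notin> E'" for \<phi> 
    using that by (auto simp: E'_def image_iff algebra_simps)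
  have per': "P (\<phi> - 2 * pi) = P \<phi>" for \<phi> using per[of "\<phi> - 2 * pi"] by simp
  have "measure lborel {\<phi> \<in> {0..<2 * pi}. P \<phi>} = (\<beta> + 2 * pi) - (\<alpha> + 2 * pi)"
  proof (rule measure_periodic_arc_nonneg[where P = P and E = E'])
    show "finite E'" using E by (simp add: E'_def)
    show "P \<phi>" if "\<alpha> + 2 * pi < \<phi>" "\<phi> < \<beta> + 2 * pi" "\<phi> \<notin> E'" for \<phi>
      using yes[of "\<phi> - 2 * pi"] that E' per' by simp
    show "\<not> P \<phi>" if "\<beta> + 2 * pi < \<phi>" "\<phi> < \<alpha> + 2 * pi + 2 * pi" "\<phi> \<notin> E'" for \<phi>
      using no[of "\<phi> - 2 * pi"] that E' per' by simp
  qed (use \<alpha> \<beta> False per in auto)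
  then show ?thesis by simp
qed

subsection \<open>Directions of a graph at a point\<close>

text \<open>A one-sided tangent angle tested by rays instead of a derivative, which admits the
  vertical tangents. The ray in direction \<open>l\<close> itself is left open, as the graph may run
  on either side of it.\<close>

definition right_dir :: "(real \<Rightarrow> real) \<Rightarrow> real \<Rightarrow> real \<Rightarrow> bool" where
  "right_dir h c l \<longleftrightarrow> \<bar>l\<bar> \<le> pi/2 \<and> (\<forall>\<phi>. \<bar>\<phi>\<bar> < pi/2 \<longrightarrow>
     (l < \<phi> \<longrightarrow> (\<forall>\<^sub>F t in at_right 0. h (c + t * cos \<phi>) < h c + t * sin \<phi>)) \<and>
     (\<phi> < l \<longrightarrow> (\<forall>\<^sub>F t in at_right 0. h c + t * sin \<phi> < h (c + t * cos \<phi>))))"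

text \<open>Here \<open>\<phi>\<close> is the angle of a line read from left to right; the ray is
  its left half, of direction \<open>\<phi> + pi\<close>.\<close>

definition left_dir :: "(real \<Rightarrow> real) \<Rightarrow> real \<Rightarrow> real \<Rightarrow> bool" where
  "left_dir h c r \<longleftrightarrow> \<bar>r\<bar> \<le> pi/2 \<and> (\<forall>\<phi>. \<bar>\<phi>\<bar> < pi/2 \<longrightarrow>
     (r < \<phi> \<longrightarrow> (\<forall>\<^sub>F t in at_right 0. h c - t * sin \<phi> < h (c - t * cos \<phi>))) \<and>
     (\<phi> < r \<longrightarrow> (\<forall>\<^sub>F t in at_right 0. h (c - t * cos \<phi>) < h c - t * sin \<phi>)))"

lemma eventually_scaled_unit:
  assumes "(0::real) < k"
  shows "\<forall>\<^sub>F t in at_right 0. 0 < t * k \<and> t * k < 1"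
  unfolding eventually_at_right_field using assms
  by (intro exI[of _ "1/k"]) (auto simp: field_simps)

lemma arc_dir_tendsto:
  assumes "good_dirs l r" "0 < k"
  shows "((\<lambda>t. arc_dir l r (t * k)) \<longlongrightarrow> l) (at_right 0)"
proof -
  have "(arc_dir l r \<longlongrightarrow> arc_dir l r 0) (at 0 within {0..1})"
    using continuous_on_arc_dir[of l r] by (auto simp: continuous_on_def)
  moreover have "filterlim (\<lambda>t. t * k) (at 0 within {0..1}) (at_right 0)"
    unfolding filterlim_at
  proof
    show "\<forall>\<^sub>F t in at_right 0. t * k \<in> {0..1} \<and> t * k \<noteq> 0"
      using eventually_scaled_unit[OF assms(2)] by eventually_elim auto
    have "((\<lambda>t. t * k) \<longlongrightarrow> 0 * k) (at_right 0)" by (intro tendsto_intros)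
    then show "((\<lambda>t. t * k) \<longlongrightarrow> 0) (at_right 0)" by simp
  qed
  ultimately show ?thesis using assms(1) by (auto dest: filterlim_compose)
qed

text \<open>The chord to the point above \<open>x0 + t * cos \<phi>\<close> has angle
  \<open>d t\<close>, the mean of \<open>l\<close> and a tangent angle tending to \<open>l\<close>.
  Hence \<open>d t\<close> is eventually on the same side of \<open>\<phi>\<close> as
  \<open>l\<close>, and \<open>tan\<close> preserves the order.\<close>

lemma arc_fun_right_dir:
  assumes g: "good_dirs l r" and x: "x0 < x1"
  shows "right_dir (arc_fun x0 x1 y0 l r) x0 l"
  unfolding right_dir_def
proof (intro conjI allI impI)
  show "\<bar>l\<bar> \<le> pi/2" using g by (simp add: good_dirs_def)
  fix \<phi> :: real assume \<phi>: "\<bar>\<phi>\<bar> < pi/2"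
  then have c0: "cos \<phi> > 0" by (intro cos_gt_zero_pi) auto
  define k where "k = cos \<phi> / (x1 - x0)"
  have k: "0 < k" using x c0 by (simp add: k_def)
  define d where "d = (\<lambda>t. (l + arc_dir l r (t * k)) / 2)"
  have "(d \<longlongrightarrow> (l + l) / 2) (at_right 0)"
    unfolding d_def by (intro tendsto_intros arc_dir_tendsto g k) simp
  then have d: "(d \<longlongrightarrow> l) (at_right 0)" by simp
  have tan_\<phi>: "t * sin \<phi> = t * cos \<phi> * tan \<phi>" for t using c0 by (simp add: tan_def)
  have f0: "arc_fun x0 x1 y0 l r x0 = y0" using g by (simp add: arc_fun_def)
  have f: "\<forall>\<^sub>F t in at_right 0. arc_fun x0 x1 y0 l r (x0 + t * cos \<phi>) = y0 + t * cos \<phi> * tan (d t) \<and> \<bar>d t\<bar> < pi/2 \<and> t * cos \<phi> > 0"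
    using eventually_scaled_unit[OF k]
  proof eventually_elim
    case (elim t)
    have "arc_fun x0 x1 y0 l r (x0 + t * cos \<phi>) = y0 + (x1 - x0) * arc_prof l r (t * k)"
      by (simp add: arc_fun_def k_def)
    also have "\<dots> = y0 + t * cos \<phi> * tan (d t)"
      using elim x unfolding d_def by (simp add: arc_prof_left[OF g] k_def)
    finally show ?case using elim arc_dir_sum_l[OF g, of "t * k"] k c0 zero_less_mult_pos2[of t k] by (auto simp: d_def)
  qed
  show "\<forall>\<^sub>F t in at_right 0. arc_fun x0 x1 y0 l r (x0 + t * cos \<phi>) < arc_fun x0 x1 y0 l r x0 + t * sin \<phi>" if "l < \<phi>"
    using f order_tendstoD(2)[OF d that]
  proof eventually_elim
    case (elim t)
    then have "tan (d t) < tan \<phi>" using \<phi> by (intro tan_monotone) auto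
    then show ?case unfolding tan_\<phi> f0 using elim mult_strict_left_mono by fastforce
  qed
  show "\<forall>\<^sub>F t in at_right 0. arc_fun x0 x1 y0 l r x0 + t * sin \<phi> < arc_fun x0 x1 y0 l r (x0 + t * cos \<phi>)" if "\<phi> < l"
    using f order_tendstoD(1)[OF d that]
  proof eventually_elim
    case (elim t)
    then have "tan \<phi> < tan (d t)" using \<phi> by (intro tan_monotone) auto
    then show ?case unfolding tan_\<phi> f0 using elim mult_strict_left_mono by fastforce
  qed
qed

lemma arc_fun_left_dir:
  assumes g: "good_dirs l r" and x: "x0 < x1"
  shows "left_dir (arc_fun x0 x1 y0 l r) x1 r"
  unfolding left_dir_def
proof (intro conjI allI impI)
  show "\<bar>r\<bar> \<le> pi/2" using g by (simp add: good_dirs_def)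
  fix \<phi> :: real assume \<phi>: "\<bar>\<phi>\<bar> < pi/2"
  then have c0: "cos \<phi> > 0" by (intro cos_gt_zero_pi) auto
  define k where "k = cos \<phi> / (x1 - x0)"
  have k: "0 < k" using x c0 by (simp add: k_def)
  define d where "d = (\<lambda>t. (r + arc_dir r l (t * k)) / 2)"
  have "(d \<longlongrightarrow> (r + r) / 2) (at_right 0)"
    unfolding d_def by (intro tendsto_intros arc_dir_tendsto good_dirs_swap[OF g] k) simp
  then have d: "(d \<longlongrightarrow> r) (at_right 0)" by simp
  have tan_\<phi>: "t * sin \<phi> = t * cos \<phi> * tan \<phi>" for t using c0 by (simp add: tan_def)
  have f: "\<forall>\<^sub>F t in at_right 0. arc_fun x0 x1 y0 l r (x1 - t * cos \<phi>) = arc_fun x0 x1 y0 l r x1 - t * cos \<phi> * tan (d t) \<and> \<bar>d t\<bar> < pi/2 \<and> t * cos \<phi> > 0"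
    using eventually_scaled_unit[OF k]
  proof eventually_elim
    case (elim t)
    have "(x1 - t * cos \<phi> - x0) / (x1 - x0) = 1 - t * k"
      using x by (simp add: k_def field_simps)
    then have "arc_fun x0 x1 y0 l r (x1 - t * cos \<phi>) = y0 + (x1 - x0) * arc_prof l r (1 - t * k)"
      by (simp add: arc_fun_def)
    also have "\<dots> = arc_fun x0 x1 y0 l r x1 - (x1 - x0) * (t * k) * tan (d t)"
      using elim x unfolding d_def 
      by (simp add: arc_prof_right[OF g] arc_fun_def arc_dir_swap algebra_simps)
    also have "(x1 - x0) * (t * k) = t * cos \<phi>" using x by (simp add: k_def)
    finally show ?case using elim arc_dir_sum_l[OF good_dirs_swap[OF g], of "t * k"] k c0 zero_less_mult_pos2[of t k] by (auto simp: d_def)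
  qed
  show "\<forall>\<^sub>F t in at_right 0. arc_fun x0 x1 y0 l r x1 - t * sin \<phi> < arc_fun x0 x1 y0 l r (x1 - t * cos \<phi>)" if "r < \<phi>"
    using f order_tendstoD(2)[OF d that]
  proof eventually_elim
    case (elim t)
    then have "tan (d t) < tan \<phi>" using \<phi> by (intro tan_monotone) auto
    then show ?case unfolding tan_\<phi> using elim mult_strict_left_mono by fastforce
  qed
  show "\<forall>\<^sub>F t in at_right 0. arc_fun x0 x1 y0 l r (x1 - t * cos \<phi>) < arc_fun x0 x1 y0 l r x1 - t * sin \<phi>" if "\<phi> < r"
    using f order_tendstoD(1)[OF d that]
  proof eventually_elim
    case (elim t)
    then have "tan \<phi> < tan (d t)" using \<phi> by (intro tan_monotone) auto
    then show ?case unfolding tan_\<phi> using elim mult_strict_left_mono by fastforce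
  qed
qed


lemma right_dirD:
  assumes "right_dir h c l" "- (pi/2) < \<phi>" "\<phi> < pi/2"
  shows "l < \<phi> \<Longrightarrow> \<forall>\<^sub>F t in at_right 0. h (c + t * cos \<phi>) < h c + t * sin \<phi>"
    "\<phi> < l \<Longrightarrow> \<forall>\<^sub>F t in at_right 0. h c + t * sin \<phi> < h (c + t * cos \<phi>)"
  using assms by (auto simp: right_dir_def)

text \<open>Now \<open>\<phi>\<close> is the direction of the ray itself, so that right and left
  rays fill one common range of angles.\<close>

lemma left_dirD:
  assumes "left_dir h c r" "pi/2 < \<phi>" "\<phi> < 3*pi/2"
  shows "\<phi> < pi + r \<Longrightarrow> \<forall>\<^sub>F t in at_right 0. h (c + t * cos \<phi>) < h c + t * sin \<phi>"
    "pi + r < \<phi> \<Longrightarrow> \<forall>\<^sub>F t in at_right 0. h c + t * sin \<phi> < h (c + t * cos \<phi>)"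
proof -
  have "\<bar>\<phi> - pi\<bar> < pi/2" using assms unfolding abs_less_iff by linarith
  then show "\<phi> < pi + r \<Longrightarrow> \<forall>\<^sub>F t in at_right 0. h (c + t * cos \<phi>) < h c + t * sin \<phi>"
    "pi + r < \<phi> \<Longrightarrow> \<forall>\<^sub>F t in at_right 0. h c + t * sin \<phi> < h (c + t * cos \<phi>)"
    using assms(1) unfolding left_dir_def
    by (auto dest!: spec[where x = "\<phi> - pi"] simp: cos_diff sin_diff)
qed

section \<open>Interior angles at the vertices of a region between two graphs\<close>

definition ray_in :: "real \<Rightarrow> real \<Rightarrow> (real \<Rightarrow> real) \<Rightarrow> (real \<Rightarrow> real) \<Rightarrow> real \<Rightarrow> real \<Rightarrow> real \<Rightarrow> bool" where
  "ray_in A B h H c y \<phi> \<longleftrightarrow> (\<forall>\<^sub>F t in at_right 0. A < c + t * cos \<phi> \<and> c + t * cos \<phi> < B \<and>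
     h (c + t * cos \<phi>) < y + t * sin \<phi> \<and> y + t * sin \<phi> < H (c + t * cos \<phi>))"

lemma ray_in_iff:
  "(\<exists>\<epsilon>>0. \<forall>t. 0 < t \<and> t < \<epsilon> \<longrightarrow>
     Complex c y + complex_of_real t * cis \<phi> \<in> graph_region A B h H) \<longleftrightarrow> ray_in A B h H c y \<phi>"
  unfolding ray_in_def eventually_at_right_field graph_region_def by auto

lemma ray_in_periodic: "ray_in A B h H c y (\<phi> + 2 * pi) = ray_in A B h H c y \<phi>"
  by (simp add: ray_in_def)

lemma ray_in_shift: "ray_in A B h H c y \<phi> = ray_in A B h H c y (\<phi> - 2 * pi)"
  using ray_in_periodic[of A B h H c y "\<phi> - 2 * pi"] by simp

lemma ray_inI:
  assumes "\<forall>\<^sub>F t in at_right 0. A < c + t * cos \<phi>" "\<forall>\<^sub>F t in at_right 0. c + t * cos \<phi> < B"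
    "\<forall>\<^sub>F t in at_right 0. h (c + t * cos \<phi>) < y + t * sin \<phi>"
    "\<forall>\<^sub>F t in at_right 0. y + t * sin \<phi> < H (c + t * cos \<phi>)"
  shows "ray_in A B h H c y \<phi>"
  unfolding ray_in_def using assms by eventually_elim auto

lemma not_ray_inI:
  assumes "\<forall>\<^sub>F t in at_right 0. c + t * cos \<phi> \<le> A \<or> B \<le> c + t * cos \<phi> \<or>
     y + t * sin \<phi> \<le> h (c + t * cos \<phi>) \<or> H (c + t * cos \<phi>) \<le> y + t * sin \<phi>"
  shows "\<not> ray_in A B h H c y \<phi>"
proof
  assume "ray_in A B h H c y \<phi>"
  with assms have "\<forall>\<^sub>F t in at_right (0::real). False" unfolding ray_in_def by eventually_elim auto
  then show False by simp
qed

lemma ray_tendsto: "((\<lambda>t. c + t * k) \<longlongrightarrow> (c::real)) (at_right 0)"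
proof -
  have "((\<lambda>t. c + t * k) \<longlongrightarrow> c + 0 * k) (at_right 0)" by (intro tendsto_intros)
  then show ?thesis by simp
qed

lemma ray_above: 
  assumes "A < (c::real)" shows "\<forall>\<^sub>F t in at_right 0. A < c + t * k"
  using order_tendstoD(1)[OF ray_tendsto assms] .

lemma ray_below: 
  assumes "(c::real) < B" shows "\<forall>\<^sub>F t in at_right 0. c + t * k < B"
  using order_tendstoD(2)[OF ray_tendsto assms] .

lemma ray_graph:
  assumes "isCont H (c::real)" 
  shows "y < H c \<Longrightarrow> \<forall>\<^sub>F t in at_right 0. y + t * s < H (c + t * k)"
    "H c < y \<Longrightarrow> \<forall>\<^sub>F t in at_right 0. H (c + t * k) < y + t * (s::real)"
proof -
  have "((\<lambda>t. H (c + t * k) - (y + t * s)) \<longlongrightarrow> H c - y) (at_right 0)"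
    by (intro tendsto_intros isCont_tendsto_compose[OF assms] ray_tendsto)
  from order_tendstoD[OF this, of 0]
  show "y < H c \<Longrightarrow> \<forall>\<^sub>F t in at_right 0. y + t * s < H (c + t * k)"
    "H c < y \<Longrightarrow> \<forall>\<^sub>F t in at_right 0. H (c + t * k) < y + t * s" by simp_all
qed

text \<open>Rays into the region turn counterclockwise from the outgoing tangent \<open>l\<close> to
  the reversed incoming tangent \<open>pi + r\<close>; the upper graph keeps its distance by
  continuity. The excluded set consists of the vertical directions, on which the one-sided tangents
  are silent.\<close>

lemma angle_at_bottom:
  assumes c: "A < c" "c < B" and l: "right_dir h c l" and r: "left_dir h c r"
    and H: "isCont H c" "h c < H c"
  shows "measure lborel {\<phi> \<in> {0..<2 * pi}. ray_in A B h H c (h c) \<phi>} = pi + r - l"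
proof (rule measure_periodic_arc[where E = "{pi/2, 3*pi/2}" and P = "ray_in A B h H c (h c)"])
  have b: "- (pi/2) \<le> l" "l \<le> pi/2" "- (pi/2) \<le> r" "r \<le> pi/2"
    using l r by (auto simp: right_dir_def left_dir_def abs_le_iff)
  show "- 2 * pi \<le> l" "l \<le> 2 * pi" "l \<le> pi + r" "pi + r \<le> l + 2 * pi"
    using b pi_gt_zero by linarith+
  note base = ray_above[OF c(1)] ray_below[OF c(2)] ray_graph(1)[OF H]
  show "ray_in A B h H c (h c) \<phi>" if "l < \<phi>" "\<phi> < pi + r" "\<phi> \<notin> {pi/2, 3*pi/2}" for \<phi>
    using that b right_dirD(1)[OF l, of \<phi>] left_dirD(1)[OF r, of \<phi>]
    by (cases "\<phi> < pi/2") (auto intro!: ray_inI base)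
  show "\<not> ray_in A B h H c (h c) \<phi>" if \<phi>: "pi + r < \<phi>" "\<phi> < l + 2 * pi" "\<phi> \<notin> {pi/2, 3*pi/2}" for \<phi>
  proof (cases "\<phi> < 3*pi/2")
    case True
    then show ?thesis using \<phi> b left_dirD(2)[OF r, of \<phi>]
      by (intro not_ray_inI) (auto elim!: eventually_mono)
  next
    case False
    then show ?thesis using \<phi> b right_dirD(2)[OF l, of "\<phi> - 2*pi"]
      unfolding ray_in_shift[of _ _ _ _ _ _ \<phi>]
      by (intro not_ray_inI) (auto elim!: eventually_mono)
  qed
qed (auto simp: ray_in_periodic)

lemma angle_at_top:
  assumes c: "A < c" "c < B" and l: "right_dir H c l" and r: "left_dir H c r"
    and h: "isCont h c" "h c < H c"
  shows "measure lborel {\<phi> \<in> {0..<2 * pi}. ray_in A B h H c (H c) \<phi>} = pi + l - r"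
proof -
  have "measure lborel {\<phi> \<in> {0..<2 * pi}. ray_in A B h H c (H c) \<phi>} = l - (r - pi)"
  proof (rule measure_periodic_arc[where E = "{-pi/2, pi/2}" and P = "ray_in A B h H c (H c)"])
    have b: "- (pi/2) \<le> l" "l \<le> pi/2" "- (pi/2) \<le> r" "r \<le> pi/2"
      using l r by (auto simp: right_dir_def left_dir_def abs_le_iff)
    show "- 2 * pi \<le> r - pi" "r - pi \<le> 2 * pi" "r - pi \<le> l" "l \<le> r - pi + 2 * pi"
      using b pi_gt_zero by linarith+
    note base = ray_above[OF c(1)] ray_below[OF c(2)] ray_graph(2)[OF h]
    show "ray_in A B h H c (H c) \<phi>" if \<phi>: "r - pi < \<phi>" "\<phi> < l" "\<phi> \<notin> {-pi/2, pi/2}" for \<phi>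
    proof (cases "\<phi> < -pi/2")
      case True
      have "ray_in A B h H c (H c) (\<phi> + 2*pi)"
        using True \<phi> b left_dirD(2)[OF r, of "\<phi> + 2*pi"] base[of "cos (\<phi> + 2*pi)"] by (intro ray_inI) auto
      then show ?thesis by (simp only: ray_in_periodic)
    next
      case False
      then show ?thesis using \<phi> b right_dirD(2)[OF l, of \<phi>]
        by (auto intro!: ray_inI base)
    qed
    show "\<not> ray_in A B h H c (H c) \<phi>" if \<phi>: "l < \<phi>" "\<phi> < r - pi + 2 * pi" "\<phi> \<notin> {-pi/2, pi/2}" for \<phi>
    proof (cases "\<phi> < pi/2")
      case True
      then show ?thesis using \<phi> b right_dirD(1)[OF l, of \<phi>]
        by (intro not_ray_inI) (auto elim!: eventually_mono)
    next
      case False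
      then show ?thesis using \<phi> b left_dirD(1)[OF r, of "\<phi>"]
        by (intro not_ray_inI) (auto elim!: eventually_mono)
    qed
  qed (auto simp: ray_in_periodic)
  then show ?thesis by simp
qed

text \<open>Both graphs leave to the right, so the admissible rays lie between their tangents. Equal
  tangents give a cusp of angle 0.\<close>

lemma angle_at_left_end:
  assumes c: "A < B" and l: "right_dir h A l" and L: "right_dir H A L"
    and "h A = H A" "l \<le> L"
  shows "measure lborel {\<phi> \<in> {0..<2 * pi}. ray_in A B h H A (h A) \<phi>} = L - l"
proof (rule measure_periodic_arc[where E = "{pi/2, 3*pi/2}" and P = "ray_in A B h H A (h A)"])
  have b: "- (pi/2) \<le> l" "l \<le> pi/2" "- (pi/2) \<le> L" "L \<le> pi/2"
    using l L by (auto simp: right_dir_def left_dir_def abs_le_iff)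
  show "- 2 * pi \<le> l" "l \<le> 2 * pi" "l \<le> L" "L \<le> l + 2 * pi"
    using b pi_gt_zero assms by linarith+
  have pos: "\<forall>\<^sub>F t in at_right 0. (0::real) < t" by (auto simp: eventually_at_right_field intro!: exI[of _ 1])
  show "ray_in A B h H A (h A) \<phi>" if \<phi>: "l < \<phi>" "\<phi> < L" "\<phi> \<notin> {pi/2, 3*pi/2}" for \<phi>
  proof -
    have "cos \<phi> > 0" using \<phi> b by (intro cos_gt_zero_pi) auto
    with pos have "\<forall>\<^sub>F t in at_right 0. A < A + t * cos \<phi>" by (auto elim!: eventually_mono)
    then show ?thesis using \<phi> b right_dirD(1)[OF l, of \<phi>] right_dirD(2)[OF L, of \<phi>] ray_below[OF c] assms(4)
      by (intro ray_inI) auto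
  qed
  show "\<not> ray_in A B h H A (h A) \<phi>" if \<phi>: "L < \<phi>" "\<phi> < l + 2 * pi" "\<phi> \<notin> {pi/2, 3*pi/2}" for \<phi>
  proof -
    consider "\<phi> < pi/2" | "pi/2 < \<phi>" "\<phi> < 3*pi/2" | "3*pi/2 < \<phi>" using \<phi>(3) by fastforce
    then show ?thesis
    proof cases
      case 1
      then show ?thesis using \<phi> b right_dirD(1)[OF L, of \<phi>] assms(4)
        by (intro not_ray_inI) (auto elim!: eventually_mono)
    next
      case 2
      then have "cos (\<phi> - pi) > 0" by (intro cos_gt_zero_pi) auto
      then have "cos \<phi> < 0" by (simp add: cos_diff)
      with pos have "\<forall>\<^sub>F t in at_right 0. A + t * cos \<phi> \<le> A"
        by (auto elim!: eventually_mono simp: mult_le_0_iff)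
      then show ?thesis by (intro not_ray_inI) (auto elim!: eventually_mono)
    next
      case 3
      then show ?thesis using \<phi> b right_dirD(2)[OF l, of "\<phi> - 2*pi"]
        unfolding ray_in_shift[of _ _ _ _ _ _ \<phi>]
        by (intro not_ray_inI) (auto elim!: eventually_mono)
    qed
  qed
qed (auto simp: ray_in_periodic)

lemma angle_at_right_end:
  assumes c: "A < B" and r: "left_dir h B r" and R: "left_dir H B R"
    and "h B = H B" "R \<le> r"
  shows "measure lborel {\<phi> \<in> {0..<2 * pi}. ray_in A B h H B (h B) \<phi>} = r - R"
proof -
  have "measure lborel {\<phi> \<in> {0..<2 * pi}. ray_in A B h H B (h B) \<phi>} = (pi + r) - (pi + R)"
  \<comment> \<open>The full turn starting at \<open>pi + R\<close> may extend up to
    \<open>7*pi/2\<close>, so one more vertical direction occurs inside it.\<close>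
  proof (rule measure_periodic_arc[where E = "{pi/2, 3*pi/2, 5*pi/2}" and P = "ray_in A B h H B (h B)"])
    have b: "- (pi/2) \<le> r" "r \<le> pi/2" "- (pi/2) \<le> R" "R \<le> pi/2"
      using r R by (auto simp: right_dir_def left_dir_def abs_le_iff)
    show "- 2 * pi \<le> pi + R" "pi + R \<le> 2 * pi" "pi + R \<le> pi + r" "pi + r \<le> pi + R + 2 * pi"
      using b pi_gt_zero assms by linarith+
    have pos: "\<forall>\<^sub>F t in at_right 0. (0::real) < t" by (auto simp: eventually_at_right_field intro!: exI[of _ 1])
    show "ray_in A B h H B (h B) \<phi>" if \<phi>: "pi + R < \<phi>" "\<phi> < pi + r" "\<phi> \<notin> {pi/2, 3*pi/2, 5*pi/2}" for \<phi>
    proof -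
      have "cos (\<phi> - pi) > 0" using \<phi> b by (intro cos_gt_zero_pi) auto
      then have "cos \<phi> < 0" by (simp add: cos_diff)
      with pos have "\<forall>\<^sub>F t in at_right 0. B + t * cos \<phi> < B" 
        by (auto elim!: eventually_mono simp: mult_less_0_iff)
      then show ?thesis using \<phi> b left_dirD(1)[OF r, of \<phi>] left_dirD(2)[OF R, of \<phi>] ray_above[OF c] assms(4)
        by (intro ray_inI) auto
    qed
    show "\<not> ray_in A B h H B (h B) \<phi>" if \<phi>: "pi + r < \<phi>" "\<phi> < pi + R + 2 * pi" "\<phi> \<notin> {pi/2, 3*pi/2, 5*pi/2}" for \<phi>
    proof -
      consider "\<phi> < 3*pi/2" | "3*pi/2 < \<phi>" "\<phi> < 5*pi/2" | "5*pi/2 < \<phi>" using \<phi>(3) by fastforce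
      then show ?thesis
      proof cases
        case 1
        then show ?thesis using \<phi> b left_dirD(2)[OF r, of \<phi>] assms(4)
          by (intro not_ray_inI) (auto elim!: eventually_mono)
      next
        case 2
        then have "cos (\<phi> - 2 * pi) > 0" by (intro cos_gt_zero_pi) auto
        then have "cos \<phi> > 0" by (simp add: cos_diff)
        with pos have "\<forall>\<^sub>F t in at_right 0. B + t * cos \<phi> \<ge> B"
          by (auto elim!: eventually_mono)
        then show ?thesis by (intro not_ray_inI) (auto elim!: eventually_mono)
      next
        case 3
        then show ?thesis using \<phi> b left_dirD(1)[OF R, of "\<phi> - 2*pi"] assms(4)
          unfolding ray_in_shift[of _ _ _ _ _ _ \<phi>]
          by (intro not_ray_inI) (auto elim!: eventually_mono)
      qed
    qed
  qed (auto simp: ray_in_periodic)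
  then show ?thesis by simp
qed

subsection \<open>Chains of arcs\<close>

text \<open>Each piece is anchored at the value of the single function \<open>h\<close> at its left
  node, and the intervals are closed. Neighbouring pieces therefore agree at their common node, and
  continuity needs no clause of its own.\<close>

definition arc_chain ::
  "nat \<Rightarrow> (nat \<Rightarrow> real) \<Rightarrow> (nat \<Rightarrow> real) \<Rightarrow> (nat \<Rightarrow> real) \<Rightarrow> (real \<Rightarrow> real) \<Rightarrow> bool" where
  "arc_chain N x l r h \<longleftrightarrow> (\<forall>i<N. x i < x (Suc i) \<and> good_dirs (l i) (r i) \<and>
     (\<forall>t\<in>{x i..x (Suc i)}. h t = arc_fun (x i) (x (Suc i)) (h (x i)) (l i) (r i) t))"

lemma arc_chainD:
  assumes "arc_chain N x l r h" "i < N"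
  shows "x i < x (Suc i)" "good_dirs (l i) (r i)"
    "\<And>t. x i \<le> t \<Longrightarrow> t \<le> x (Suc i) \<Longrightarrow> h t = arc_fun (x i) (x (Suc i)) (h (x i)) (l i) (r i) t"
proof -
  have i: "x i < x (Suc i) \<and> good_dirs (l i) (r i) \<and>
     (\<forall>t\<in>{x i..x (Suc i)}. h t = arc_fun (x i) (x (Suc i)) (h (x i)) (l i) (r i) t)"
    using assms(1)[unfolded arc_chain_def, rule_format, OF assms(2)] .
  from i show "x i < x (Suc i)" by (elim conjE)
  from i show "good_dirs (l i) (r i)" by (elim conjE)
  fix t assume "x i \<le> t" "t \<le> x (Suc i)"
  then have "t \<in> {x i..x (Suc i)}" by simp
  with i show "h t = arc_fun (x i) (x (Suc i)) (h (x i)) (l i) (r i) t" by (elim conjE) (rule bspec)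
qed

lemma arc_chain_less:
  assumes "arc_chain N x l r h" "i < j" "j \<le> N"
  shows "x i < x j"
  using assms(2,3)
proof (induction j)
  case (Suc j)
  then show ?case using arc_chainD(1)[OF assms(1), of j] by (cases "i = j") auto
qed auto

lemma arc_chain_mono:
  assumes "arc_chain N x l r h" "i \<le> j" "j \<le> N"
  shows "x i \<le> x j"
  using arc_chain_less[OF assms(1), of i j] assms by (cases "i = j") auto

lemma arc_chain_subset: "arc_chain N x l r h \<Longrightarrow> k \<le> N \<Longrightarrow> arc_chain k x l r h"
  unfolding arc_chain_def by (intro allI impI) (erule allE, erule mp, erule (1) less_le_trans)

lemma arc_chain_cover:
  assumes "arc_chain N x l r h" "N \<ge> 1"
  shows "(\<Union>i<N. {x i..x (Suc i)}) = {x 0..x N}"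
  using assms
proof (induction N)
  case (Suc N)
  show ?case
  proof (cases "N = 0")
    case False
    then have "(\<Union>i<N. {x i..x (Suc i)}) = {x 0..x N}"
      using Suc arc_chain_subset by fastforce
    moreover have "x 0 \<le> x N" "x N < x (Suc N)"
      using arc_chain_mono[OF Suc.prems(1), of 0 N] arc_chainD(1)[OF Suc.prems(1), of N] by auto
    ultimately show ?thesis by (auto simp: lessThan_Suc)
  qed auto
qed auto

lemma continuous_on_arc_fun:
  assumes "good_dirs l r" "x0 < x1"
  shows "continuous_on {x0..x1} (arc_fun x0 x1 y0 l r)"
proof -
  have "continuous_on {x0..x1} (\<lambda>t. (t - x0) / (x1 - x0))"
    using assms(2) by (intro continuous_intros) auto
  then have "continuous_on {x0..x1} (\<lambda>t. arc_prof l r ((t - x0) / (x1 - x0)))"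
    using assms(2) by (intro continuous_on_compose2[OF continuous_on_arc_prof[OF assms(1)]]) auto
  then show ?thesis unfolding arc_fun_def by (intro continuous_intros)
qed

lemma continuous_on_arc_chain:
  assumes "arc_chain N x l r h" "N \<ge> 1"
  shows "continuous_on {x 0..x N} h"
  unfolding arc_chain_cover[OF assms, symmetric]
proof (intro continuous_on_closed_Union)
  fix i assume i: "i \<in> {..<N}"
  have "continuous_on {x i..x (Suc i)} h \<longleftrightarrow> continuous_on {x i..x (Suc i)} (arc_fun (x i) (x (Suc i)) (h (x i)) (l i) (r i))"
    by (intro continuous_on_cong refl arc_chainD(3)[OF assms(1)]) (use i in auto)
  then show "continuous_on {x i..x (Suc i)} h"
    using continuous_on_arc_fun[OF arc_chainD(2,1)[OF assms(1)]] i by blast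
qed auto

lemma arc_chain_right_dir:
  assumes "arc_chain N x l r h" "i < N"
  shows "right_dir h (x i) (l i)"
proof -
  note D = arc_chainD[OF assms]
  define f where "f = arc_fun (x i) (x (Suc i)) (h (x i)) (l i) (r i)"
  have fd: "right_dir f (x i) (l i)" unfolding f_def by (rule arc_fun_right_dir[OF D(2,1)])
  have hx: "h (x i) = f (x i)" unfolding f_def by (rule D(3)) (use D(1) in auto)
  have ev: "\<forall>\<^sub>F t in at_right 0. h (x i + t * cos \<phi>) = f (x i + t * cos \<phi>)" if "\<bar>\<phi>\<bar> < pi/2" for \<phi>
  proof -
    have c: "cos \<phi> > 0" using that by (intro cos_gt_zero_pi) auto
    have "\<forall>\<^sub>F t in at_right 0. (0::real) < t" by (auto simp: eventually_at_right_field intro!: exI[of _ 1])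
    then show ?thesis using ray_below[OF D(1), of "cos \<phi>"]
      by eventually_elim (unfold f_def, rule D(3), use c in auto)
  qed
  show ?thesis unfolding right_dir_def
  proof (intro conjI allI impI)
    show "\<bar>l i\<bar> \<le> pi / 2" using fd by (simp add: right_dir_def)
    fix \<phi> :: real assume \<phi>: "\<bar>\<phi>\<bar> < pi/2"
    have fd': "l i < \<phi> \<Longrightarrow> \<forall>\<^sub>F t in at_right 0. f (x i + t * cos \<phi>) < f (x i) + t * sin \<phi>"
      "\<phi> < l i \<Longrightarrow> \<forall>\<^sub>F t in at_right 0. f (x i) + t * sin \<phi> < f (x i + t * cos \<phi>)"
      using fd \<phi> by (auto simp: right_dir_def)
    show "\<forall>\<^sub>F t in at_right 0. h (x i + t * cos \<phi>) < h (x i) + t * sin \<phi>" if "l i < \<phi>"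
      using ev[OF \<phi>] fd'(1)[OF that] by eventually_elim (simp add: hx)
    show "\<forall>\<^sub>F t in at_right 0. h (x i) + t * sin \<phi> < h (x i + t * cos \<phi>)" if "\<phi> < l i"
      using ev[OF \<phi>] fd'(2)[OF that] by eventually_elim (simp add: hx)
  qed
qed

lemma arc_chain_left_dir:
  assumes "arc_chain N x l r h" "i < N"
  shows "left_dir h (x (Suc i)) (r i)"
proof -
  note D = arc_chainD[OF assms]
  define f where "f = arc_fun (x i) (x (Suc i)) (h (x i)) (l i) (r i)"
  have fd: "left_dir f (x (Suc i)) (r i)" unfolding f_def by (rule arc_fun_left_dir[OF D(2,1)])
  have hx: "h (x (Suc i)) = f (x (Suc i))" unfolding f_def by (rule D(3)) (use D(1) in auto)
  have ev: "\<forall>\<^sub>F t in at_right 0. h (x (Suc i) - t * cos \<phi>) = f (x (Suc i) - t * cos \<phi>)" if "\<bar>\<phi>\<bar> < pi/2" for \<phi>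
  proof -
    have c: "cos \<phi> > 0" using that by (intro cos_gt_zero_pi) auto
    have "\<forall>\<^sub>F t in at_right 0. (0::real) < t" by (auto simp: eventually_at_right_field intro!: exI[of _ 1])
    then show ?thesis using ray_above[OF D(1), of "- cos \<phi>"]
      by eventually_elim (unfold f_def, rule D(3), use c in auto)
  qed
  show ?thesis unfolding left_dir_def
  proof (intro conjI allI impI)
    show "\<bar>r i\<bar> \<le> pi / 2" using fd by (simp add: left_dir_def)
    fix \<phi> :: real assume \<phi>: "\<bar>\<phi>\<bar> < pi/2"
    have f': "r i < \<phi> \<Longrightarrow> \<forall>\<^sub>F t in at_right 0. f (x (Suc i)) - t * sin \<phi> < f (x (Suc i) - t * cos \<phi>)"
      "\<phi> < r i \<Longrightarrow> \<forall>\<^sub>F t in at_right 0. f (x (Suc i) - t * cos \<phi>) < f (x (Suc i)) - t * sin \<phi>"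
      using fd \<phi> by (auto simp: left_dir_def)
    show "\<forall>\<^sub>F t in at_right 0. h (x (Suc i)) - t * sin \<phi> < h (x (Suc i) - t * cos \<phi>)" if "r i < \<phi>"
      using ev[OF \<phi>] f'(1)[OF that] by eventually_elim (simp add: hx)
    show "\<forall>\<^sub>F t in at_right 0. h (x (Suc i) - t * cos \<phi>) < h (x (Suc i)) - t * sin \<phi>" if "\<phi> < r i"
      using ev[OF \<phi>] f'(2)[OF that] by eventually_elim (simp add: hx)
  qed
qed

lemma arc_chain_overlap:
  assumes c: "arc_chain N x l r h" and "i < j" "j < N"
    and "t \<le> x (Suc i)" "x j \<le> t"
  shows "j = Suc i \<and> t = x j"
proof -
  have "\<not> Suc i < j" using arc_chain_less[OF c, of "Suc i" j] assms by auto
  then have "j = Suc i" using assms(2) by linarith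
  then show ?thesis using assms(4,5) by simp
qed


section \<open>From two chains with common ends to a simple polygon\<close>

lemma arc_path_image_chain:
  assumes c: "arc_chain N x l r h" and i: "i < N"
  shows "path_image (arc_path (x i) (x (Suc i)) (h (x i)) (l i) (r i)) = (\<lambda>t. Complex t (h t)) ` {x i..x (Suc i)}"
  unfolding arc_path_image[OF arc_chainD(2,1)[OF c i]]
  by (intro image_cong refl) (metis arc_chainD(3)[OF c i] atLeastAtMost_iff)

lemma arc_edge_chain:
  assumes c: "arc_chain N x l r h" and i: "i < N"
  shows "arc_edge (Complex (x i) (h (x i))) (Complex (x (Suc i)) (h (x (Suc i))))
    (arc_path (x i) (x (Suc i)) (h (x i)) (l i) (r i))"
proof -
  have "h (x (Suc i)) = arc_fun (x i) (x (Suc i)) (h (x i)) (l i) (r i) (x (Suc i))"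
    by (rule arc_chainD(3)[OF c i]) (use arc_chainD(1)[OF c i] in auto)
  then show ?thesis using arc_path_arc_edge[OF arc_chainD(2,1)[OF c i]] by metis
qed

lemma arc_edge_reversepath:
  assumes "arc_edge a b g" shows "arc_edge b a (reversepath g)"
proof -
  have "reversepath g = linepath b a \<or> (\<exists>c r s t. r > 0 \<and> t \<noteq> 0 \<and> \<bar>t\<bar> < 2 * pi \<and>
     reversepath g = (\<lambda>x. c + complex_of_real r * cis (s + t * x)))"
  proof (cases "g = linepath a b")
    case False
    then obtain c r s t where "r > 0" "t \<noteq> 0" "\<bar>t\<bar> < 2 * pi" and
      g: "g = (\<lambda>x. c + complex_of_real r * cis (s + t * x))"
      using assms unfolding arc_edge_def by blast
    moreover have "reversepath g = (\<lambda>x. c + complex_of_real r * cis ((s + t) + (- t) * x))"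
      unfolding g reversepath_def by (simp add: algebra_simps)
    ultimately show ?thesis
      by (intro disjI2 exI[of _ c] exI[of _ r] exI[of _ "s + t"] exI[of _ "- t"]) auto
  qed auto
  then show ?thesis using assms by (auto simp: arc_edge_def reversepath_def)
qed

text \<open>The upper chain is indexed from left to right, so its node \<open>k\<close> is the vertex \<open>n - k\<close>.\<close>

theorem two_chain_polygon:
  assumes bot: "arc_chain N x l r h" and top: "arc_chain M X L R H"
    and N: "N \<ge> 1" and M: "M \<ge> 1" and n: "n = N + M" "n \<ge> 2"
    and X: "X 0 = x 0" "X M = x N" and eq: "h (x 0) = H (x 0)" "h (x N) = H (x N)"
    and less: "\<And>t. x 0 < t \<Longrightarrow> t < x N \<Longrightarrow> h t < H t"
    and LR: "l 0 \<le> L 0" "R (M - 1) \<le> r (N - 1)"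
    and ang0: "\<theta> 0 = L 0 - l 0" and angN: "\<theta> N = r (N - 1) - R (M - 1)"
    and ang_bot: "\<And>i. 0 < i \<Longrightarrow> i < N \<Longrightarrow> \<theta> i = pi + r (i - 1) - l i"
    and ang_top: "\<And>k. 0 < k \<Longrightarrow> k < M \<Longrightarrow> \<theta> (n - k) = pi + L k - R (k - 1)"
  shows "\<exists>v g. simple_arc_polygon n v g \<and> (\<forall>i<n. interior_angle n v g i = \<theta> i)"
proof -
  define v where "v i = (if i \<le> N then Complex (x i) (h (x i)) else Complex (X (n - i)) (H (X (n - i))))" for i
  define g where "g i = (if i < N then arc_path (x i) (x (Suc i)) (h (x i)) (l i) (r i)
    else reversepath (arc_path (X (n - Suc i)) (X (Suc (n - Suc i))) (H (X (n - Suc i))) (L (n - Suc i)) (R (n - Suc i))))" for i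
  have v_top: "v i = Complex (X (n - i)) (H (X (n - i)))" if "N \<le> i" "i \<le> n" for i
    using that n X eq by (cases "i = N") (auto simp: v_def)
  have v_bot: "v i = Complex (x i) (h (x i))" if "i \<le> N" for i
    using that by (simp add: v_def)
  \<comment> \<open>By its defining formula \<open>v n\<close> is the left end of the upper chain,
    hence equal to \<open>v 0\<close>; from here on indices can be used without reduction modulo
    \<open>n\<close>.\<close>
  have v_mod: "v (Suc i mod n) = v (Suc i)" if "i < n" for i
  proof (cases "Suc i = n")
    case True
    then show ?thesis using v_top[of n] v_bot[of 0] n X eq by simp
  next
    case False
    then show ?thesis using that by simp
  qed
  have nn: "Suc (n - Suc i) = n - i" if "i < n" for i using that by simp
  have img_bot: "path_image (g i) = (\<lambda>t. Complex t (h t)) ` {x i..x (Suc i)}" if "i < N" for i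
    using arc_path_image_chain[OF bot that] that by (simp add: g_def)
  have img_top: "path_image (g i) = (\<lambda>t. Complex t (H t)) ` {X (n - Suc i)..X (n - i)}" if "N \<le> i" "i < n" for i
  proof -
    have "n - Suc i < M" using that n by auto
    then show ?thesis using arc_path_image_chain[OF top, of "n - Suc i"] that nn[OF that(2)]
      by (simp add: g_def)
  qed
  have edge: "arc_edge (v i) (v (Suc i)) (g i)" if "i < n" for i
  proof (cases "i < N")
    case True
    then show ?thesis using arc_edge_chain[OF bot True] by (simp add: v_bot g_def)
  next
    case False
    then have "n - Suc i < M" using that n by auto
    from arc_edge_reversepath[OF arc_edge_chain[OF top this]] show ?thesis
      using False that nn[OF that] v_top[of i] v_top[of "Suc i"] by (simp add: g_def)
  qed
  have x_less: "x i < x j" if "i < j" "j \<le> N" for i j using arc_chain_less[OF bot that] .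
  have X_less: "X i < X j" if "i < j" "j \<le> M" for i j using arc_chain_less[OF top that] .
  have x_mono: "x i \<le> x j" if "i \<le> j" "j \<le> N" for i j using arc_chain_mono[OF bot that] .
  have X_mono: "X i \<le> X j" if "i \<le> j" "j \<le> M" for i j using arc_chain_mono[OF top that] .
  \<comment> \<open>A lower and an upper edge can only share one of the two common ends, and each
    end belongs to just one edge of each chain.\<close>
  have hH: "t = x 0 \<or> t = x N" if "x 0 \<le> t" "t \<le> x N" "h t = H t" for t
    using less[of t] that by fastforce
  have v_ne: "v i \<noteq> v j" if ij: "i < j" "j < n" for i j
  proof -
    consider "j \<le> N" | "i \<le> N" "N < j" | "N < i" using ij by linarith
    then show ?thesis
    proof cases
      case 1
      then show ?thesis using x_less[of i j] ij by (simp add: v_bot)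
    next
      case 2
      have "0 < n - j" "n - j < M" using 2 ij n by auto
      then have "x 0 < X (n - j)" "X (n - j) < x N" using X_less[of 0 "n - j"] X_less[of "n-j" M] X by auto
      then show ?thesis using less[of "X (n - j)"] 2 ij by (auto simp: v_bot v_top)
    next
      case 3
      then have "n - j < n - i" "n - i \<le> M" using ij n by auto
      from X_less[OF this] show ?thesis using 3 ij by (simp add: v_top)
    qed
  qed
  have inj: "inj_on v {..<n}"
    by (intro inj_onI) (metis lessThan_iff linorder_neqE_nat v_ne)
  have inter: "path_image (g i) \<inter> path_image (g j) \<subseteq> {v i, v (Suc i)} \<inter> {v j, v (Suc j)}"
    if ij: "i < j" "j < n" for i j
  proof
    fix z assume z: "z \<in> path_image (g i) \<inter> path_image (g j)"
    consider "j < N" | "i < N" "N \<le> j" | "N \<le> i" using ij by linarith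
    then show "z \<in> {v i, v (Suc i)} \<inter> {v j, v (Suc j)}"
    proof cases
      case 1
      then obtain t where t: "z = Complex t (h t)" "t \<le> x (Suc i)" "x j \<le> t"
        using z ij by (auto simp: img_bot)
      then show ?thesis using arc_chain_overlap[OF bot ij(1) 1 t(2,3)] 1 by (auto simp: v_bot)
    next
      case 2
      then obtain t where t: "z = Complex t (h t)" "h t = H t" "x i \<le> t" "t \<le> x (Suc i)"
         "X (n - Suc j) \<le> t" "t \<le> X (n - j)"
        using z ij by (auto simp: img_bot img_top)
      have "t = x 0 \<or> t = x N" using hH[of t] t x_mono[of 0 i] x_mono[of "Suc i" N] 2 by auto
      then show ?thesis
      proof
        assume t0: "t = x 0"
        then have "i = 0" using x_less[of 0 i] t 2 by fastforce
        moreover have "n - Suc j = 0" using X_less[of 0 "n - Suc j"] X t t0 n 2 by fastforce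
        ultimately show ?thesis using t t0 X eq ij v_top[of "Suc j"] n 2 by (auto simp: v_bot)
      next
        assume tN: "t = x N"
        then have "Suc i = N" using x_less[of "Suc i" N] t 2 by fastforce
        moreover have "j = N" using X_less[of "n - j" M] X t tN n 2 ij by fastforce
        ultimately show ?thesis using t tN by (auto simp: v_bot)
      qed
    next
      case 3
      then obtain t where t: "z = Complex t (H t)" "t \<le> X (Suc (n - Suc j))" "X (n - Suc i) \<le> t"
        using z ij nn[of j] by (auto simp: img_top)
      have "n - Suc j < n - Suc i" "n - Suc i < M" using 3 ij n by auto
      from arc_chain_overlap[OF top this t(2,3)]
      have "n - Suc i = Suc (n - Suc j)" "t = X (n - Suc i)" by auto
      then have "j = Suc i" "z = v (Suc i)" using ij 3 t by (auto simp: v_top)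
      then show ?thesis by auto
    qed
  qed
  have simple: "simple_arc_polygon n v g"
    unfolding simple_arc_polygon_def
  proof (intro conjI allI impI)
    fix i j assume "i < n" "j < n" "i \<noteq> j"
    then show "path_image (g i) \<inter> path_image (g j) \<subseteq> {v i, v (Suc i mod n)} \<inter> {v j, v (Suc j mod n)}"
      using inter[of i j] inter[of j i] v_mod by (cases "i < j") auto
  qed (use n inj edge v_mod in auto)
  have ch: "continuous_on {x 0..x N} h" by (rule continuous_on_arc_chain[OF bot N])
  have cH: "continuous_on {x 0..x N} H" using continuous_on_arc_chain[OF top M] X by simp
  have U1: "(\<Union>i<N. path_image (g i)) = (\<lambda>t. Complex t (h t)) ` {x 0..x N}"
    unfolding arc_chain_cover[OF bot N, symmetric] image_UN using img_bot by auto
  have U2: "(\<Union>i\<in>{N..<n}. path_image (g i)) = (\<lambda>t. Complex t (H t)) ` {x 0..x N}"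
  proof -
    have "(\<Union>i\<in>{N..<n}. path_image (g i)) = (\<Union>i\<in>{N..<n}. (\<lambda>t. Complex t (H t)) ` {X (n - Suc i)..X (Suc (n - Suc i))})"
      using img_top nn by (intro SUP_cong) auto
    also have "\<dots> = (\<Union>k\<in>(\<lambda>i. n - Suc i) ` {N..<n}. (\<lambda>t. Complex t (H t)) ` {X k..X (Suc k)})"
      by simp
    also have "(\<lambda>i. n - Suc i) ` {N..<n} = {..<M}"
    proof (intro equalityI subsetI)
      fix k assume "k \<in> {..<M}"
      then show "k \<in> (\<lambda>i. n - Suc i) ` {N..<n}" using n by (intro image_eqI[of _ _ "n - Suc k"]) auto
    qed (use n in auto)
    finally show ?thesis using arc_chain_cover[OF top M] X by (simp add: image_UN[symmetric])
  qed
  have "{..<n} = {..<N} \<union> {N..<n}" using n by auto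
  then have "(\<Union>i<n. path_image (g i)) = (\<lambda>t. Complex t (h t)) ` {x 0..x N} \<union> (\<lambda>t. Complex t (H t)) ` {x 0..x N}"
    using U1 U2 by (simp add: UN_Un)
  then have ins: "arc_polygon_interior n g = graph_region (x 0) (x N) h H"
    unfolding arc_polygon_interior_def using inside_between_graphs[OF ch cH eq less] by simp
  have AB: "x 0 < x N" using x_less[of 0 N] N by simp
  have cont: "isCont h t" "isCont H t" if "x 0 < t" "t < x N" for t
    using continuous_on_interior[OF ch, of t] continuous_on_interior[OF cH, of t] that by auto
  have angle: "interior_angle n v g i = measure lborel {\<phi> \<in> {0..<2 * pi}. ray_in (x 0) (x N) h H c y \<phi>}"
    if "v i = Complex c y" for i c y
    unfolding interior_angle_def ins that ray_in_iff ..
  have "interior_angle n v g i = \<theta> i" if i: "i < n" for i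
  proof -
    consider "i = 0" | "0 < i" "i < N" | "i = N" | "N < i" by linarith
    then show ?thesis
    proof cases
      case 1
      have "right_dir H (x 0) (L 0)" using arc_chain_right_dir[OF top, of 0] M X by simp
      from angle_at_left_end[OF AB arc_chain_right_dir[OF bot, of 0] this eq(1) LR(1)]
      show ?thesis using 1 angle[of 0] N by (simp add: v_bot ang0)
    next
      case 2
      then have x: "x 0 < x i" "x i < x N" using x_less[of 0 i] x_less[of i N] by auto
      have "left_dir h (x i) (r (i - 1))" using arc_chain_left_dir[OF bot, of "i - 1"] 2 by simp
      from angle_at_bottom[OF x arc_chain_right_dir[OF bot, of i] this cont(2)[OF x] less[OF x]]
      show ?thesis using 2 angle[of i] ang_bot[of i] by (simp add: v_bot)
    next
      case 3
      have "left_dir H (x N) (R (M - 1))" using arc_chain_left_dir[OF top, of "M - 1"] M X by simp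
      moreover have "left_dir h (x N) (r (N - 1))" using arc_chain_left_dir[OF bot, of "N - 1"] N by simp
      ultimately have "measure lborel {\<phi> \<in> {0..<2 * pi}. ray_in (x 0) (x N) h H (x N) (h (x N)) \<phi>} =
          r (N - 1) - R (M - 1)"
        by (intro angle_at_right_end[OF AB]) (use eq LR in auto)
      then show ?thesis using 3 angle[of N] angN by (simp add: v_bot)
    next
      case 4
      define k where "k = n - i"
      have k: "0 < k" "k < M" and ik: "i = n - k" using 4 i n by (auto simp: k_def)
      then have x: "x 0 < X k" "X k < x N" using X_less[of 0 k] X_less[of k M] X by auto
      have "left_dir H (X k) (R (k - 1))" using arc_chain_left_dir[OF top, of "k - 1"] k by simp
      from angle_at_top[OF x arc_chain_right_dir[OF top, of k] this cont(1)[OF x] less[OF x]]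
      show ?thesis using k angle[of i] v_top[of i] 4 i ang_top[OF k] by (simp add: ik k_def[symmetric])
    qed
  qed
  with simple show ?thesis by blast
qed


subsection \<open>A chain closed up by a single concave arc\<close>

lemma arc_fun_left_end: "good_dirs l r \<Longrightarrow> arc_fun x0 x1 y0 l r x0 = y0"
  by (simp add: arc_fun_def)

lemma arc_fun_right_end: 
  assumes "good_dirs l r" "x0 < x1" 
  shows "arc_fun x0 x1 y0 l r x1 = y0 + (x1 - x0) * tan ((l + r)/2)"
  using assms by (simp add: arc_fun_def arc_prof_1)

lemma arc_fun_from_left:
  assumes "good_dirs l r" "x0 < t" "t \<le> x1"
  shows "arc_fun x0 x1 y0 l r t = y0 + (t - x0) * tan ((l + arc_dir l r ((t - x0)/(x1 - x0)))/2)"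
  using assms by (simp add: arc_fun_def arc_prof_left)

lemma arc_fun_from_right:
  assumes "good_dirs l r" "x0 \<le> t" "t < x1"
  shows "arc_fun x0 x1 y0 l r t =
    arc_fun x0 x1 y0 l r x1 - (x1 - t) * tan ((r + arc_dir r l ((x1 - t)/(x1 - x0)))/2)"
proof -
  have *: "1 - (t - x0)/(x1 - x0) = (x1 - t)/(x1 - x0)" using assms by (simp add: field_simps)
  have "arc_fun x0 x1 y0 l r t = y0 + (x1 - x0) * (arc_prof l r 1 - (1 - (t - x0)/(x1 - x0)) * 
     tan ((r + arc_dir l r ((t - x0)/(x1 - x0)))/2))"
    unfolding arc_fun_def using assms by (subst arc_prof_right) auto
  also have "arc_dir l r ((t - x0)/(x1 - x0)) = arc_dir r l ((x1 - t)/(x1 - x0))"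
    unfolding *[symmetric] by (simp add: arc_dir_swap)
  finally show ?thesis using assms unfolding * by (simp add: arc_fun_def right_diff_distrib)
qed

text \<open>The chord to the point at \<open>t\<close> has angle at most the mean of
  \<open>l\<close> and \<open>r\<close> when the arc bends upwards, and strictly less than
  \<open>l\<close> when it bends downwards. So \<open>l = \<kappa>\<close>, tangency to the line at
  the start, is allowed.\<close>

lemma arc_fun_below_from_left:
  assumes g: "good_dirs l r" and t: "x0 < t" "t \<le> x1" and "l \<le> \<kappa>" "(l + r)/2 < \<kappa>" "\<kappa> < pi/2"
  shows "arc_fun x0 x1 y0 l r t < y0 + (t - x0) * tan \<kappa>"
proof -
  define \<xi> where "\<xi> = (t - x0)/(x1 - x0)"
  have \<xi>: "0 < \<xi>" "\<xi> \<le> 1" using t by (auto simp: \<xi>_def)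
  have "(l + arc_dir l r \<xi>)/2 < \<kappa>"
    using arc_dir_le(1)[OF g, of \<xi>] arc_dir_less_l(1)[OF g \<xi>] \<xi> assms(4,5) by (auto simp: max_def split: if_splits)
  then have "tan ((l + arc_dir l r \<xi>)/2) < tan \<kappa>"
    using arc_dir_sum_l[OF g \<xi>] assms(6) by (intro tan_monotone) auto
  then show ?thesis using arc_fun_from_left[OF g t, of y0] t by (simp add: \<xi>_def)
qed

lemma arc_fun_below_from_right:
  assumes g: "good_dirs l r" and t: "x0 \<le> t" "t < x1" and "\<kappa> \<le> r" "\<kappa> < (l + r)/2" "- (pi/2) < \<kappa>"
  shows "arc_fun x0 x1 y0 l r t < arc_fun x0 x1 y0 l r x1 - (x1 - t) * tan \<kappa>"
proof -
  define \<xi> where "\<xi> = (x1 - t)/(x1 - x0)"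
  have \<xi>: "0 < \<xi>" "\<xi> \<le> 1" using t by (auto simp: \<xi>_def)
  note g' = good_dirs_swap[OF g]
  have "\<kappa> < (r + arc_dir r l \<xi>)/2"
    using arc_dir_le(2)[OF g', of \<xi>] arc_dir_less_l(2)[OF g' \<xi>] \<xi> assms(4,5)
    by (cases "r < l") (auto simp: min_def split: if_splits)
  then have "tan \<kappa> < tan ((r + arc_dir r l \<xi>)/2)"
    using arc_dir_sum_l[OF g' \<xi>] assms(6) by (intro tan_monotone) auto
  then show ?thesis using arc_fun_from_right[OF g t, of y0] t by (simp add: \<xi>_def)
qed

text \<open>For a concave arc the tangent angle never falls below \<open>e\<close>, so the chord
  from the left end to an inner point is at least as steep as the whole chord.\<close>

lemma arc_fun_above_chord:
  assumes g: "good_dirs s e" and t: "x0 \<le> t" "t \<le> x1" and "e \<le> s"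
  shows "y0 + (t - x0) * tan ((s + e)/2) \<le> arc_fun x0 x1 y0 s e t"
proof (cases "t = x0")
  case True
  then show ?thesis using g by (simp add: arc_fun_left_end)
next
  case False
  then have t': "x0 < t" using t by simp
  define \<xi> where "\<xi> = (t - x0)/(x1 - x0)"
  have \<xi>: "0 < \<xi>" "\<xi> \<le> 1" using t t' by (auto simp: \<xi>_def)
  have "(s + e)/2 \<le> (s + arc_dir s e \<xi>)/2"
    using arc_dir_le(2)[OF g, of \<xi>] \<xi> assms(4) by (auto simp: min_def split: if_splits)
  moreover have "\<bar>s + e\<bar> < pi" using g by (simp add: good_dirs_def)
  ultimately have "tan ((s + e)/2) \<le> tan ((s + arc_dir s e \<xi>)/2)"
    using arc_dir_sum_l[OF g \<xi>] by (subst tan_mono_le_eq) auto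
  then show ?thesis using arc_fun_from_left[OF g t' t(2), of y0] t by (simp add: \<xi>_def mult_left_mono)
qed

lemma arc_chain_exists:
  assumes "\<And>i. i < N \<Longrightarrow> x i < x (Suc i)" "\<And>i. i < N \<Longrightarrow> good_dirs (l i) (r i)"
  shows "\<exists>h. arc_chain N x l r h \<and> h (x 0) = y0"
  using assms
proof (induction N)
  case 0
  then show ?case by (intro exI[of _ "\<lambda>_. y0"]) (simp add: arc_chain_def)
next
  case (Suc N)
  then obtain h where h: "arc_chain N x l r h" "h (x 0) = y0" by force
  define f where "f = arc_fun (x N) (x (Suc N)) (h (x N)) (l N) (r N)"
  define h' where "h' t = (if t \<le> x N then h t else f t)" for t
  have "arc_chain (Suc N) x l r h'"
    unfolding arc_chain_def
  proof (intro allI impI conjI ballI)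
    fix i assume i: "i < Suc N"
    show "x i < x (Suc i)" "good_dirs (l i) (r i)" using Suc i by auto
    fix t assume t: "t \<in> {x i..x (Suc i)}"
    show "h' t = arc_fun (x i) (x (Suc i)) (h' (x i)) (l i) (r i) t"
    proof (cases "i = N")
      case True
      have "f (x N) = h (x N)" unfolding f_def using Suc.prems(2)[of N] by (simp add: arc_fun_left_end)
      then have "h' t = f t" using True t by (cases "t = x N") (auto simp: h'_def)
      then show ?thesis using True by (simp add: f_def h'_def)
    next
      case False
      then have i: "i < N" using i by simp
      have "x i \<le> x N" "x (Suc i) \<le> x N"
        using arc_chain_mono[OF h(1)] i by auto
      then have "h' t = h t" "h' (x i) = h (x i)" using t by (auto simp: h'_def)
      then show ?thesis using arc_chainD(3)[OF h(1) i, of t] t by simp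
    qed
  qed
  moreover have "h' (x 0) = y0" using arc_chain_mono[OF h(1), of 0 N] h(2) by (simp add: h'_def)
  ultimately show ?case by blast
qed

lemma arc_chain_next:
  assumes "arc_chain N x l r h" "i < N"
  shows "h (x (Suc i)) = h (x i) + (x (Suc i) - x i) * tan ((l i + r i)/2)"
proof -
  have "h (x (Suc i)) = arc_fun (x i) (x (Suc i)) (h (x i)) (l i) (r i) (x (Suc i))"
    by (rule arc_chainD(3)[OF assms]) (use arc_chainD(1)[OF assms] in auto)
  also have "\<dots> = h (x i) + (x (Suc i) - x i) * tan ((l i + r i)/2)"
    by (rule arc_fun_right_end[OF arc_chainD(2,1)[OF assms]])
  finally show ?thesis .
qed

lemma good_dirs_tan_mono:
  assumes "good_dirs l r" "good_dirs s e" "l + r < s + e"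
  shows "tan ((l + r)/2) < tan ((s + e)/2)"
  using assms by (intro tan_monotone) (auto simp: good_dirs_def abs_less_iff)

text \<open>The outer two edges carry the whole drop and rise; all other edges are scaled down so far that
  they stay below the chord.\<close>

lemma chain_below_chord:
  assumes N: "N \<ge> 2" and g: "\<And>i. i < N \<Longrightarrow> good_dirs (l i) (r i)" and g0: "good_dirs s e"
    and \<kappa>: "\<kappa> = (s + e)/2" and le: "l 0 \<le> \<kappa>" "\<kappa> \<le> r (N - 1)"
    and less: "(l 0 + r 0)/2 < \<kappa>" "\<kappa> < (l (N - 1) + r (N - 1))/2"
  shows "\<exists>x h. arc_chain N x l r h \<and> x 0 = 0 \<and> h 0 = 0 \<and> h (x N) = x N * tan \<kappa> \<and>
    (\<forall>t. 0 < t \<and> t < x N \<longrightarrow> h t < t * tan \<kappa>)"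
proof -
  define K where "K = tan \<kappa>"
  \<comment> \<open>Slope of edge \<open>i\<close> in excess of the slope of the closing chord;
    \<open>f i\<close> is the corresponding height profile over the unit interval.\<close>
  define c where "c i = tan ((l i + r i)/2) - K" for i
  define f where "f i \<xi> = arc_prof (l i) (r i) \<xi> - K * \<xi>" for i \<xi>
  have c0: "c 0 < 0" using good_dirs_tan_mono[OF g[of 0] g0] less(1) N by (simp add: c_def K_def \<kappa>)
  have cN: "c (N - 1) > 0" using good_dirs_tan_mono[OF g0 g[of "N - 1"]] less(2) N by (simp add: c_def K_def \<kappa>)
  have fc: "f i 1 = c i" if "i < N" for i using arc_prof_1[OF g[OF that]] by (simp add: f_def c_def)
  have "\<exists>b. \<forall>\<xi>\<in>{0..1}. \<bar>f i \<xi>\<bar> \<le> b" if "i < N" for i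
  proof -
    have "continuous_on {0..1} (f i)" unfolding f_def
      by (intro continuous_intros continuous_on_arc_prof g that)
    then have "bounded (f i ` {0..1})" by (intro compact_imp_bounded compact_continuous_image) auto
    then show ?thesis by (auto simp: bounded_iff)
  qed
  then obtain b where b: "\<And>i \<xi>. i < N \<Longrightarrow> 0 \<le> \<xi> \<Longrightarrow> \<xi> \<le> 1 \<Longrightarrow> \<bar>f i \<xi>\<bar> \<le> b i"
    by (metis atLeastAtMost_iff)
  define C where "C = 1 + (\<Sum>i<N. \<bar>b i\<bar>)"
  have C1: "C \<ge> 1" by (simp add: C_def sum_nonneg)
  have C: "\<bar>f i \<xi>\<bar> \<le> C" if "i < N" "0 \<le> \<xi>" "\<xi> \<le> 1" for i \<xi>
    using b[OF that] member_le_sum[of i "{..<N}" "\<lambda>i. \<bar>b i\<bar>"] that unfolding C_def by auto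
  have cC: "\<bar>c i\<bar> \<le> C" if "i < N" for i using C[OF that, of 1] fc[OF that] by simp
  \<comment> \<open>After the first edge the chain is at height -1 relative to the chord. With this
    width, fewer than \<open>N\<close> inner edges, each changing the height by at most
    \<open>\<delta> * C\<close>, cannot make up for that.\<close>
  define \<delta> where "\<delta> = 1 / (real N * C)"
  have \<delta>0: "\<delta> > 0" using C1 N by (simp add: \<delta>_def)
  have \<delta>N: "\<delta> * (real k * C) < 1" if "k < N" for k
    using that C1 N by (simp add: \<delta>_def divide_simps)
  define S where "S i = \<delta> * (\<Sum>j\<in>{1..<i}. c j)" for i
  have S: "\<bar>S i\<bar> \<le> \<delta> * (real (i - 1) * C)" if "i \<le> N" for i
  proof -
    have "\<bar>\<Sum>j\<in>{1..<i}. c j\<bar> \<le> (\<Sum>j\<in>{1..<i}. C)"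
      using that by (intro order_trans[OF sum_abs] sum_mono cC) auto
    then show ?thesis using \<delta>0 by (simp add: S_def abs_mult)
  qed
  have SN: "S (N - 1) < 1" using S[of "N - 1"] \<delta>N[of "N - 1 - 1"] N by simp
  \<comment> \<open>Widths of the edges: the first drops by exactly 1, the inner ones contribute
    \<open>S (N - 1)\<close> in total, and the last one rises by the remaining
    \<open>1 - S (N - 1)\<close>.\<close>
  define \<gamma> where "\<gamma> i = (if i = 0 then 1 / (- c 0) else if i = N - 1 then (1 - S (N - 1)) / c (N - 1) else \<delta>)" for i
  have \<gamma>: "\<gamma> i > 0" for i using c0 cN SN \<delta>0 by (auto simp: \<gamma>_def intro!: divide_neg_neg divide_pos_neg)
  define x where "x i = (\<Sum>j<i. \<gamma> j)" for i
  have x0: "x 0 = 0" and xS: "x (Suc i) = x i + \<gamma> i" for i by (simp_all add: x_def)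
  obtain h where h: "arc_chain N x l r h" "h (x 0) = 0"
    using arc_chain_exists[of N x l r 0] g xS \<gamma> by auto
  define z where "z i = h (x i) - K * x i" for i
  have z0: "z 0 = 0" using h x0 by (simp add: z_def)
  have zS: "z (Suc i) = z i + \<gamma> i * c i" if "i < N" for i
    using arc_chain_next[OF h(1) that] by (simp add: z_def c_def xS algebra_simps)
  have z: "z i = S i - 1" if "1 \<le> i" "i \<le> N - 1" for i
    using that
  proof (induction i rule: dec_induct)
    case base
    show ?case using zS[of 0] N z0 c0 by (simp add: \<gamma>_def S_def)
  next
    case (step i)
    then show ?case using zS[of i] by (simp add: \<gamma>_def S_def distrib_left)
  qed
  have "z (Suc (N - 1)) = 0" using zS[of "N - 1"] z[of "N - 1"] N cN by (simp add: \<gamma>_def)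
  then have zN: "z N = 0" using N by simp
  have \<kappa>b: "- (pi/2) < \<kappa>" "\<kappa> < pi/2" using g0 by (auto simp: \<kappa> good_dirs_def abs_less_iff)
  have "h t < t * K" if t: "0 < t" "t < x N" for t
  proof -
    have "t \<in> (\<Union>i<N. {x i..x (Suc i)})"
      using N t x0 arc_chain_cover[OF h(1)] by auto
    then obtain i where i: "i < N" "x i \<le> t" "t \<le> x (Suc i)" by auto
    note ht = arc_chainD(3)[OF h(1) i]
    consider "i = 0" | "i = N - 1" "i \<noteq> 0" | "0 < i" "i < N - 1" using i by linarith
    then show ?thesis
    proof cases
      case 1
      then show ?thesis unfolding ht
        using arc_fun_below_from_left[OF g[OF i(1)], of "x i" t "x (Suc i)" \<kappa> "h (x i)"] le less t i \<kappa>b x0 h(2)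
        by (simp add: K_def)
    next
      case 2
      then have iN: "Suc i = N" using N by simp
      have "h (x N) = arc_fun (x i) (x (Suc i)) (h (x i)) (l i) (r i) (x N)"
        using arc_chainD(3)[OF h(1) i(1), of "x N"] i t unfolding iN by simp
      then have "h t < h (x N) - (x N - t) * K" unfolding ht
        using arc_fun_below_from_right[OF g[OF i(1)], of "x i" t "x (Suc i)" \<kappa> "h (x i)"] le less t i \<kappa>b 2(1)
        unfolding iN by (simp add: K_def)
      then show ?thesis using zN by (simp add: z_def algebra_simps)
    next
      case 3
      then have \<gamma>i: "\<gamma> i = \<delta>" by (simp add: \<gamma>_def)
      define \<xi> where "\<xi> = (t - x i)/\<delta>"
      have \<xi>: "0 \<le> \<xi>" "\<xi> \<le> 1" using i \<delta>0 by (auto simp: \<xi>_def xS \<gamma>i)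
      have t': "t = x i + \<delta> * \<xi>" using \<delta>0 by (simp add: \<xi>_def)
      have "h t - t * K = z i + \<delta> * f i \<xi>"
        unfolding ht using \<gamma>i by (simp add: arc_fun_def xS f_def z_def \<xi>_def[symmetric]) (simp add: t' algebra_simps)
      \<comment> \<open>The \<open>i - 1\<close> inner edges already passed, plus the current one,
        make \<open>i\<close> contributions.\<close>
      also have "\<dots> \<le> (\<delta> * (real (i - 1) * C) - 1) + \<delta> * C"
        using z[of i] S[OF less_imp_le[OF i(1)]] 3 C[OF i(1) \<xi>] \<delta>0 by (intro add_mono mult_left_mono) auto
      also have "\<dots> = \<delta> * (real i * C) - 1" using 3 by (cases i) (auto simp: algebra_simps)
      also have "\<dots> < 0" using \<delta>N[OF i(1)] by simp
      finally show ?thesis by simp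
    qed
  qed
  moreover have "h (x N) = x N * K" using zN by (simp add: z_def)
  ultimately show ?thesis using h x0 unfolding K_def by auto
qed

section \<open>Subdividing an arc by vertices of angle pi\<close>

lemma arc_dir_subarc:
  assumes "0 \<le> a" "a \<le> 1" "0 \<le> b" "b \<le> 1"
  shows "arc_dir (arc_dir s e a) (arc_dir s e b) \<xi> = arc_dir s e (a + \<xi> * (b - a))"
proof -
  have "arc_dir (arc_dir s e a) (arc_dir s e b) \<xi> =
    arcsin (sin (arc_dir s e a) + \<xi> * (sin (arc_dir s e b) - sin (arc_dir s e a)))"
    by (simp only: arc_dir_def)
  also have "\<dots> = arc_dir s e (a + \<xi> * (b - a))"
    unfolding sin_arc_dir[OF assms(1,2)] sin_arc_dir[OF assms(3,4)]
    by (simp add: arc_dir_def algebra_simps)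
  finally show ?thesis .
qed

lemma arc_dir_inject:
  assumes g: "good_dirs s e" "s \<noteq> e" and ab: "0 \<le> a" "a \<le> 1" "0 \<le> b" "b \<le> 1" "a \<noteq> b"
  shows "arc_dir s e a \<noteq> arc_dir s e b"
proof
  assume "arc_dir s e a = arc_dir s e b"
  then have "sin (arc_dir s e a) = sin (arc_dir s e b)" by simp
  then have "a * (sin e - sin s) = b * (sin e - sin s)" using ab by (simp add: sin_arc_dir)
  then show False using sin_inj_half_pi[of s e] g ab(5) by (auto simp: good_dirs_def)
qed

lemma good_dirs_subarc:
  assumes g: "good_dirs s e" and ab: "0 \<le> a" "a \<le> 1" "0 \<le> b" "b \<le> 1" "a \<noteq> b"
  shows "good_dirs (arc_dir s e a) (arc_dir s e b)"
proof (cases "s = e")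
  case True
  then show ?thesis using g by (auto simp: arc_dir_same)
next
  case False
  then show ?thesis using arc_dir_inject[OF g False ab] arc_dir_bounded[OF ab(1,2), of s e] arc_dir_bounded[OF ab(3,4), of s e]
    by (auto simp: good_dirs_def abs_le_iff abs_less_iff)
qed

lemma arc_prof_subarc:
  assumes g: "good_dirs s e" and ab: "0 \<le> a" "a \<le> 1" "0 \<le> b" "b \<le> 1" "a \<noteq> b"
  shows "arc_prof s e (a + \<xi> * (b - a)) = arc_prof s e a + (b - a) * arc_prof (arc_dir s e a) (arc_dir s e b) \<xi>"
proof (cases "s = e")
  case True
  then show ?thesis using g by (auto simp: arc_prof_def arc_dir_same algebra_simps)
next
  case False
  have ne: "sin e - sin s \<noteq> 0" using sin_inj_half_pi[of s e] g False by (auto simp: good_dirs_def)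
  have d: "sin (arc_dir s e b) - sin (arc_dir s e a) = (b - a) * (sin e - sin s)"
    using ab by (simp add: sin_arc_dir algebra_simps)
  show ?thesis using False arc_dir_inject[OF g False ab] ne ab(5)
    unfolding arc_prof_def d arc_dir_subarc[OF ab(1-4)] by (simp add: divide_simps)
qed

text \<open>Since the sine of the tangent angle is affine in the abscissa, restricting to a
  subinterval gives an arc of the same kind. The right direction of one piece is the left direction
  of the next, so every new node has angle \<pi>.\<close>

lemma arc_chain_subdivide:
  assumes g: "good_dirs s e" and B: "0 < B" and M: "M \<ge> 1"
  shows "arc_chain M (\<lambda>k. real k * B / real M) (\<lambda>k. arc_dir s e (real k / real M))
    (\<lambda>k. arc_dir s e (real (Suc k) / real M)) (arc_fun 0 B y0 s e)"
  unfolding arc_chain_def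
proof (intro allI impI conjI ballI)
  fix k assume k: "k < M"
  define a b where "a = real k / real M" and "b = real (Suc k) / real M"
  have ab: "0 \<le> a" "a \<le> 1" "0 \<le> b" "b \<le> 1" "a \<noteq> b" "b - a > 0"
    using k M by (auto simp: a_def b_def divide_simps)
  have X: "real k * B / real M = a * B" "real (Suc k) * B / real M = b * B"
    by (simp_all add: a_def b_def)
  show "real k * B / real M < real (Suc k) * B / real M"
    unfolding X using ab B by simp
  show "good_dirs (arc_dir s e (real k / real M)) (arc_dir s e (real (Suc k) / real M))"
    unfolding a_def[symmetric] b_def[symmetric] by (rule good_dirs_subarc[OF g ab(1-5)])
  fix t assume "t \<in> {real k * B / real M..real (Suc k) * B / real M}"
  define \<xi> where "\<xi> = (t - a * B) / (b * B - a * B)"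
  have bB: "b * B - a * B \<noteq> 0" using ab B by (simp add: left_diff_distrib[symmetric])
  have "t = a * B + \<xi> * (b * B - a * B)" using bB by (simp add: \<xi>_def)
  then have tB: "t / B = a + \<xi> * (b - a)" using B by (simp add: field_simps)
  have L: "arc_fun 0 B y0 s e t = y0 + B * arc_prof s e (a + \<xi> * (b - a))"
    and L0: "arc_fun 0 B y0 s e (a * B) = y0 + B * arc_prof s e a"
    using B by (simp_all add: arc_fun_def tB)
  have R: "arc_fun (a * B) (b * B) y d d' t = y + (b * B - a * B) * arc_prof d d' \<xi>" for y d d'
    by (simp only: arc_fun_def \<xi>_def)
  show "arc_fun 0 B y0 s e t = arc_fun (real k * B / real M) (real (Suc k) * B / real M)
      (arc_fun 0 B y0 s e (real k * B / real M)) (arc_dir s e (real k / real M)) (arc_dir s e (real (Suc k) / real M)) t"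
    unfolding X a_def[symmetric] b_def[symmetric] L L0 R
    unfolding arc_prof_subarc[OF g ab(1-5)] by (simp add: algebra_simps)
qed

text \<open>All lengths have disappeared: realising the angles is reduced to inequalities between
  directions. The chord of the cap separates the two chains, strictly from the lower one.\<close>

theorem cap_polygon:
  assumes N: "N \<ge> 2" and M: "M \<ge> 1" and n: "n = N + M"
    and g: "\<And>i. i < N \<Longrightarrow> good_dirs (l i) (r i)" and g0: "good_dirs s e" "e \<le> s"
    and \<kappa>: "\<kappa> = (s + e)/2" and le: "l 0 \<le> \<kappa>" "\<kappa> \<le> r (N - 1)"
    and less: "(l 0 + r 0)/2 < \<kappa>" "\<kappa> < (l (N - 1) + r (N - 1))/2"
    and ang0: "\<theta> 0 = s - l 0" and angN: "\<theta> N = r (N - 1) - e"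
    and ang_bot: "\<And>i. 0 < i \<Longrightarrow> i < N \<Longrightarrow> \<theta> i = pi + r (i - 1) - l i"
    and ang_top: "\<And>i. N < i \<Longrightarrow> i < n \<Longrightarrow> \<theta> i = pi"
  shows "\<exists>v g. simple_arc_polygon n v g \<and> (\<forall>i<n. interior_angle n v g i = \<theta> i)"
proof -
  obtain x h where h: "arc_chain N x l r h" "x 0 = 0" "h 0 = 0" "h (x N) = x N * tan \<kappa>"
    and below: "\<And>t. 0 < t \<Longrightarrow> t < x N \<Longrightarrow> h t < t * tan \<kappa>"
    using chain_below_chord[OF N g g0(1) \<kappa> le less] by blast
  have B: "0 < x N" using arc_chain_less[OF h(1), of 0 N] N h(2) by simp
  show ?thesis
  proof (rule two_chain_polygon[OF h(1) arc_chain_subdivide[OF g0(1) B M, of 0]])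
    show "h (x 0) = arc_fun 0 (x N) 0 s e (x 0)" using h g0 by (simp add: arc_fun_left_end)
    show "h (x N) = arc_fun 0 (x N) 0 s e (x N)"
      using h g0 B by (simp add: arc_fun_right_end \<kappa>)
    show "h t < arc_fun 0 (x N) 0 s e t" if "x 0 < t" "t < x N" for t
      using below[of t] arc_fun_above_chord[OF g0(1), of 0 t "x N" 0] that h g0(2) by (simp add: \<kappa>)
    show "\<theta> (n - k) = pi + arc_dir s e (real k / real M) - arc_dir s e (real (Suc (k - 1)) / real M)"
      if "0 < k" "k < M" for k
      using ang_top[of "n - k"] that n by simp
  qed (use N M n h g0 \<kappa> le ang0 angN ang_bot in auto)
qed


subsection \<open>Realizable sequences of angles\<close>

definition realizable :: "nat \<Rightarrow> (nat \<Rightarrow> real) \<Rightarrow> bool" where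
  "realizable n \<theta> \<longleftrightarrow> (\<exists>v g. simple_arc_polygon n v g \<and> (\<forall>i<n. interior_angle n v g i = \<theta> i))"

lemma realizable_rotate:
  assumes n: "n \<ge> 1" and real: "realizable n \<theta>'" and eq: "\<And>i. i < n \<Longrightarrow> \<theta> i = \<theta>' ((i + k) mod n)"
  shows "realizable n \<theta>"
proof -
  obtain v g where vg: "simple_arc_polygon n v g" "\<And>i. i < n \<Longrightarrow> interior_angle n v g i = \<theta>' i"
    using real by (auto simp: realizable_def)
  define \<rho> where "\<rho> i = (i + k) mod n" for i
  have \<rho>: "\<rho> i < n" for i using n by (simp add: \<rho>_def)
  have \<rho>S: "\<rho> (Suc i mod n) = Suc (\<rho> i) mod n" for i by (simp add: \<rho>_def mod_simps)
  \<comment> \<open>Adding \<open>n - k mod n\<close> undoes the shift by \<open>k\<close> modulo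
    \<open>n\<close>, which gives injectivity.\<close>
  have k: "k + (n - k mod n) = n * (k div n + 1)"
  proof -
    have "k mod n < n" "k = n * (k div n) + k mod n" using n by simp_all
    then have "k + (n - k mod n) = n * (k div n) + n" by linarith
    then show ?thesis by simp
  qed
  have inj: "inj_on \<rho> {..<n}"
  proof (rule inj_onI)
    fix i j assume ij: "i \<in> {..<n}" "j \<in> {..<n}" "\<rho> i = \<rho> j"
    then have "((i + k) mod n + (n - k mod n)) mod n = ((j + k) mod n + (n - k mod n)) mod n"
      by (simp add: \<rho>_def)
    then have "i mod n = j mod n" by (simp only: mod_add_left_eq add.assoc k mod_mult_self2)
    then show "i = j" using ij by simp
  qed
  have sur: "\<rho> ` {..<n} = {..<n}" using inj \<rho> by (intro endo_inj_surj) auto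
  have "simple_arc_polygon n (v \<circ> \<rho>) (g \<circ> \<rho>)"
    unfolding simple_arc_polygon_def
  proof (intro conjI allI impI)
    have v: "inj_on v {..<n}" and "n \<ge> 2" using vg(1) by (auto simp: simple_arc_polygon_def)
    show "n \<ge> 2" by fact
    show "inj_on (v \<circ> \<rho>) {..<n}" using comp_inj_on[OF inj] v sur by auto
    show "arc_edge ((v \<circ> \<rho>) i) ((v \<circ> \<rho>) (Suc i mod n)) ((g \<circ> \<rho>) i)" if "i < n" for i
      using vg(1) \<rho> by (simp add: \<rho>S simple_arc_polygon_def)
    fix i j assume ij: "i < n" "j < n" "i \<noteq> j"
    then have "\<rho> i \<noteq> \<rho> j" using inj by (auto simp: inj_on_def)
    then show "path_image ((g \<circ> \<rho>) i) \<inter> path_image ((g \<circ> \<rho>) j)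
      \<subseteq> {(v \<circ> \<rho>) i, (v \<circ> \<rho>) (Suc i mod n)} \<inter> {(v \<circ> \<rho>) j, (v \<circ> \<rho>) (Suc j mod n)}"
      using vg(1) \<rho>[of i] \<rho>[of j] unfolding simple_arc_polygon_def comp_def \<rho>S by blast
  qed
  moreover have "arc_polygon_interior n (g \<circ> \<rho>) = arc_polygon_interior n g"
  proof -
    have "(\<Union>i<n. path_image ((g \<circ> \<rho>) i)) = (\<Union>i\<in>\<rho> ` {..<n}. path_image (g i))" by simp
    then show ?thesis unfolding arc_polygon_interior_def sur by simp
  qed
  then have "interior_angle n (v \<circ> \<rho>) (g \<circ> \<rho>) i = interior_angle n v g (\<rho> i)" for i
    by (simp add: interior_angle_def)
  then have "interior_angle n (v \<circ> \<rho>) (g \<circ> \<rho>) i = \<theta> i" if "i < n" for i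
    using that vg(2)[OF \<rho>] eq by (simp add: \<rho>_def)
  ultimately show ?thesis unfolding realizable_def by blast
qed

text \<open>The upper arc has end angles \<open>a + (p - q)/2\<close> and \<open>(p - q)/2 - a\<close>, hence a chord of angle
  \<open>(p - q)/2\<close> and curvature controlled by \<open>a\<close>; at a lower vertex \<open>i\<close> the incoming tangent has angle
  \<open>- u i\<close>.\<close>

lemma realizable_cap:
  assumes N: "N \<ge> 2" and M: "M \<ge> 1" and n: "n = N + M"
    and \<theta>: "\<And>i. i < n \<Longrightarrow> 0 \<le> \<theta> i \<and> \<theta> i \<le> pi"
    and p: "p = \<theta> 0" and q: "q = \<theta> N" and top: "\<And>i. N < i \<Longrightarrow> i < n \<Longrightarrow> \<theta> i = pi"
    and \<mu>: "\<mu> = (p + q)/2" and pq: "\<bar>p - q\<bar> < pi"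
    and a: "0 \<le> a" "\<mu> - pi/2 \<le> a" "a \<le> pi/2 - \<bar>p - q\<bar>/2" "a \<le> \<mu> - \<bar>p - q\<bar>/2"
    and u: "\<And>i. 0 < i \<Longrightarrow> i < N \<Longrightarrow> pi/2 - \<theta> i \<le> u i \<and> u i \<le> pi/2"
    and u1: "a - \<mu> - (p - q) < u 1" and uN: "a - \<mu> + (p - q) < pi - \<theta> (N - 1) - u (N - 1)"
    and first: "\<bar>a - \<mu> - u 1\<bar> < pi" and last: "\<bar>pi - \<theta> (N - 1) - u (N - 1) + \<mu> - a\<bar> < pi"
    and mid: "\<And>i. 0 < i \<Longrightarrow> i < N - 1 \<Longrightarrow> \<bar>pi - \<theta> i - u i - u (Suc i)\<bar> < pi"
  shows "realizable n \<theta>"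
  unfolding realizable_def
proof -
  \<comment> \<open>These values are forced. The angle \<open>p\<close> at vertex 0 gives
    \<open>l 0 = a + (p - q)/2 - p = a - \<mu>\<close>, the angle \<open>q\<close> gives the last
    \<open>r\<close> likewise, and at an inner vertex \<open>l i\<close> is the incoming angle
    \<open>- u i\<close> plus the exterior angle \<open>pi - \<theta> i\<close>.\<close>
  define l where "l i = (if i = 0 then a - \<mu> else pi - \<theta> i - u i)" for i
  define r where "r i = (if i = N - 1 then \<mu> - a else - u (Suc i))" for i
  have a\<mu>: "\<bar>a - \<mu>\<bar> \<le> pi/2" "a \<le> \<mu> + (p - q)/2" "a \<le> \<mu> - (p - q)/2"
  proof -
    have "0 \<le> \<bar>p - q\<bar> / 2" by simp
    then have "a - \<mu> \<le> pi/2" using a(4) pi_gt_zero by argo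
    moreover have "- (a - \<mu>) \<le> pi/2" using a(2) by argo
    ultimately show "\<bar>a - \<mu>\<bar> \<le> pi/2" by (simp only: abs_le_iff)
    have "p - q \<le> \<bar>p - q\<bar>" "- (p - q) \<le> \<bar>p - q\<bar>" by auto
    then show "a \<le> \<mu> + (p - q)/2" "a \<le> \<mu> - (p - q)/2"
      using a(4) by (simp_all add: field_simps)
  qed
  have lb: "\<bar>l i\<bar> \<le> pi/2" if "i < N" for i
  proof (cases "i = 0")
    case True
    then show ?thesis using a\<mu>(1) by (simp add: l_def)
  next
    case False
    then have "pi/2 - \<theta> i \<le> u i" "u i \<le> pi/2" "\<theta> i \<le> pi" using u[of i] \<theta>[of i] that n by auto
    then have "l i \<le> pi/2" "- l i \<le> pi/2" using False by (simp_all add: l_def)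
    then show ?thesis by (simp only: abs_le_iff)
  qed
  have rb: "\<bar>r i\<bar> \<le> pi/2" if "i < N" for i
  proof (cases "i = N - 1")
    case True
    then show ?thesis using a\<mu>(1) by (simp add: r_def abs_minus_commute)
  next
    case False
    then have "Suc i < N" using that by linarith
    then show ?thesis using False u[of "Suc i"] \<theta>[of "Suc i"] n by (auto simp: r_def abs_le_iff)
  qed
  have lr: "\<bar>l i + r i\<bar> < pi" if i: "i < N" for i
  proof -
    consider "i = 0" | "i \<noteq> 0" "i = N - 1" | "0 < i" "i < N - 1" using i by linarith
    then show ?thesis
    proof cases
      case 1
      then show ?thesis using first N by (simp add: l_def r_def)
    next
      case 2
      then show ?thesis using last N by (simp add: l_def r_def algebra_simps)
    next
      case 3
      then show ?thesis using mid[OF 3] by (simp add: l_def r_def)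
    qed
  qed
  show "\<exists>v g. simple_arc_polygon n v g \<and> (\<forall>i<n. interior_angle n v g i = \<theta> i)"
  proof (rule cap_polygon[OF N M n, of l r "a + (p - q)/2" "(p - q)/2 - a" "(p - q)/2"])
    show "good_dirs (l i) (r i)" if "i < N" for i using lb lr rb that by (simp add: good_dirs_def)
    have "- \<bar>p - q\<bar> \<le> p - q" "p - q \<le> \<bar>p - q\<bar>" by auto
    then show "good_dirs (a + (p - q)/2) ((p - q)/2 - a)"
      using a(1,3) pq unfolding good_dirs_def abs_le_iff by (intro conjI) (simp_all add: field_simps)
    show "l 0 \<le> (p - q)/2" "(p - q)/2 \<le> r (N - 1)" using a\<mu> by (auto simp: l_def r_def field_simps)
    show "(l 0 + r 0)/2 < (p - q)/2" using u1 N by (simp add: l_def r_def)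
    show "(p - q)/2 < (l (N - 1) + r (N - 1))/2" using uN N by (simp add: l_def r_def)
    show "\<theta> 0 = a + (p - q)/2 - l 0" using \<mu> p by (simp add: l_def field_simps)
    show "\<theta> N = r (N - 1) - ((p - q)/2 - a)" using \<mu> q by (simp add: r_def field_simps)
    show "\<theta> i = pi + r (i - 1) - l i" if "0 < i" "i < N" for i
      using that by (auto simp: r_def l_def)
  qed (use a top in auto)
qed

text \<open>The closed interval may be a single point: at a vertex of angle 0 both tangents are
  vertical and there is nothing to choose.\<close>

lemma ex_in_intervals:
  fixes a b c d :: real
  assumes "a \<le> b" "a < d" "c < b" "c < d"
  shows "\<exists>w. a \<le> w \<and> w \<le> b \<and> c < w \<and> w < d"
proof (cases "a = b")
  case True
  then show ?thesis using assms by auto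
next
  case False
  then obtain w where "max a c < w" "w < min b d"
    using dense[of "max a c" "min b d"] assms by auto
  then show ?thesis by (intro exI[of _ w]) auto
qed

text \<open>The first edge bounds \<open>u 1\<close> below by \<open>m1\<close>; the last edge
  bounds \<open>u (N - 1)\<close> above by \<open>pi - \<theta> (N - 1) - m2\<close>. With
  \<open>N \<ge> 3\<close> these are two separate choices; with \<open>N = 2\<close> one number has
  to satisfy both.\<close>

lemma realizable_two_nonflat:
  assumes N: "N \<ge> 2" "N < n" and \<theta>: "\<And>i. i < n \<Longrightarrow> 0 \<le> \<theta> i \<and> \<theta> i \<le> pi"
    and less: "\<theta> 0 < pi" "\<theta> N < pi" and top: "\<And>i. N < i \<Longrightarrow> i < n \<Longrightarrow> \<theta> i = pi"
    and ex: "\<not> (N = 2 \<and> \<theta> 0 = 0 \<and> \<theta> 2 = 0 \<and> \<theta> 1 = pi)"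
  shows "realizable n \<theta>"
proof -
  define p q where "p = \<theta> 0" and "q = \<theta> N"
  define \<mu> where "\<mu> = (p + q)/2"
  define d where "d = \<bar>p - q\<bar>/2"
  have pq: "0 \<le> p" "p < pi" "0 \<le> q" "q < pi" using \<theta>[of 0] \<theta>[of N] N less by (auto simp: p_def q_def)
  have d: "p - q \<le> 2*d" "q - p \<le> 2*d" "d < pi/2" "d \<le> \<mu>" "\<mu> + d < pi" "d \<ge> 0"
    using pq by (auto simp: d_def \<mu>_def abs_if field_simps)
  \<comment> \<open>A straight cap suffices while \<open>\<mu> < pi/2\<close>. Otherwise the first
    and last lower edges would be too steep, and \<open>a\<close> is taken midway between the bounds
    \<open>\<mu> - pi/2\<close> and \<open>pi/2 - d\<close>.\<close>
  define a where "a = (if \<mu> < pi/2 then 0 else (\<mu> - d)/2)"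
  have a: "0 \<le> a" "\<mu> - pi/2 < a" "a \<le> pi/2 - d" "a \<le> \<mu> - d"
    using d pi_gt_zero by (auto simp: a_def field_simps)
  \<comment> \<open>If \<open>a = \<mu>\<close>, the first and last lower tangents are horizontal;
    this happens only with two cusps.\<close>
  have a0: "a < \<mu> \<or> (p = 0 \<and> q = 0)"
  proof (cases "\<mu> < pi/2")
    case True
    then show ?thesis using pq by (auto simp: a_def \<mu>_def)
  next
    case False
    then have "0 < \<mu>" using pi_gt_zero by linarith
    then show ?thesis using False d(6) by (simp add: a_def)
  qed
  define m1 where "m1 = a - \<mu> - (p - q)"
  define m2 where "m2 = a - \<mu> + (p - q)"
  have m: "m1 < pi/2" using a(4) d(2,3) unfolding m1_def by linarith
  have m': "m2 < pi/2" using a(4) d(1,3) unfolding m2_def by linarith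
  have m12: "m1 + m2 = 2 * (a - \<mu>)" by (simp add: m1_def m2_def)
  have n: "n = N + (n - N)" "n - N \<ge> 1" using N by auto
  have a': "\<mu> - pi/2 \<le> a" "a \<le> pi/2 - \<bar>p - q\<bar>/2" "a \<le> \<mu> - \<bar>p - q\<bar>/2"  "\<bar>p - q\<bar> < pi"
    using a(2,3,4) d(3) unfolding d_def by simp_all
  have am: "- (pi/2) < a - \<mu>" using a(2) by linarith
  have am': "a - \<mu> \<le> 0" using a(4) d(6) by linarith
  show ?thesis
  proof (cases "N = 2")
    case True
    define t where "t = \<theta> 1"
    have t: "0 \<le> t" "t \<le> pi" using \<theta>[of 1] N by (auto simp: t_def)
    \<comment> \<open>The left side is \<open>2 * (a - \<mu>) \<le> 0\<close> and the right side is
      at least 0. Both vanish only if \<open>p = q = 0\<close> and \<open>t = pi\<close>, which is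
      ruled out.\<close>
    have m3: "m1 + m2 < pi - t" using m12 a0 ex True t am am' by (auto simp: p_def q_def t_def)
    have "pi/2 - t \<le> pi/2" "pi/2 - t < pi - t - m2" "m1 < pi/2" "m1 < pi - t - m2"
      using m m' m3 t by simp_all
    from ex_in_intervals[OF this] obtain w where
      w: "pi/2 - t \<le> w" "w \<le> pi/2" "m1 < w" "m2 < pi - t - w"
      by (auto simp: algebra_simps)
    show ?thesis
    proof (rule realizable_cap[OF N(1) n(2,1) \<theta> p_def q_def top \<mu>_def a'(4) a(1) a'(1-3), of "\<lambda>_. w"])
      show "\<bar>a - \<mu> - w\<bar> < pi" "\<bar>pi - \<theta> (N - 1) - w + \<mu> - a\<bar> < pi"
        using w am am' t True unfolding abs_less_iff by (auto simp: t_def)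
      show "pi/2 - \<theta> i \<le> w \<and> w \<le> pi/2" if "0 < i" "i < N" for i
      proof -
        have "i = 1" using that True by simp
        then show ?thesis using w by (simp add: t_def)
      qed
    qed (use w True in \<open>auto simp: m1_def m2_def t_def\<close>)
  next
    case False
    then have N3: "N \<ge> 3" using N by simp
    define t where "t = \<theta> 1"
    have t: "0 \<le> t" "t \<le> pi" using \<theta>[of 1] N by (auto simp: t_def)
    \<comment> \<open>The additional bounds \<open>- (pi/2) < w\<close> and
      \<open>w < 3*pi/2 - t\<close> prevent arriving vertically upwards and leaving vertically
      downwards. Without such directions no chord between inner vertices is vertical.\<close>
    have "max m1 (- (pi/2)) < pi/2" using m pi_gt_zero unfolding max_less_iff_conj by auto
    moreover have "m1 < 3*pi/2 - t" using m t by linarith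
    moreover have "- (pi/2) < 3*pi/2 - t" using t pi_gt_zero by linarith
    ultimately have "pi/2 - t \<le> pi/2" "pi/2 - t < 3*pi/2 - t" "max m1 (- (pi/2)) < pi/2" "max m1 (- (pi/2)) < 3*pi/2 - t"
      using t by simp_all
    from ex_in_intervals[OF this] obtain w where
      w: "pi/2 - t \<le> w" "w \<le> pi/2" "m1 < w" "- (pi/2) < w" "w < 3*pi/2 - t"
      by auto
    define t' where "t' = \<theta> (N - 1)"
    have t': "0 \<le> t'" "t' \<le> pi" using \<theta>[of "N - 1"] N by (auto simp: t'_def)
    have "pi/2 - t' < 3*pi/2 - t'" "pi/2 - t' < pi - t' - m2" using m' pi_gt_zero by simp_all
    then have b1: "pi/2 - t' < min (3*pi/2 - t') (pi - t' - m2)" by (simp only: min_less_iff_conj)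
    have "- (pi/2) < 3*pi/2 - t'" using t' pi_gt_zero by linarith
    moreover have "- (pi/2) < pi - t' - m2" using m' t' by linarith
    ultimately have b2: "- (pi/2) < min (3*pi/2 - t') (pi - t' - m2)" by (simp only: min_less_iff_conj)
    have b3: "pi/2 - t' \<le> pi/2" "- (pi/2) < pi/2" using t' pi_gt_zero by simp_all
    from ex_in_intervals[OF b3(1) b1 b3(2) b2] obtain w' where
      w': "pi/2 - t' \<le> w'" "w' \<le> pi/2" "m2 < pi - t' - w'" "- (pi/2) < w'" "w' < 3*pi/2 - t'"
      by (auto simp: algebra_simps)
    \<comment> \<open>At the remaining inner vertices the exterior angle is split evenly.\<close>
    define u where "u i = (if i = 1 then w else if i = N - 1 then w' else (pi - \<theta> i)/2)" for i
    have u: "pi/2 - \<theta> i \<le> u i" "u i \<le> pi/2" "- (pi/2) < u i" "u i < 3*pi/2 - \<theta> i" if "0 < i" "i < N" for i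
      using w w' \<theta>[of i] that N pi_gt_zero by (auto simp: u_def t_def t'_def field_simps)
    have u1: "u 1 = w" "u (N - 1) = w'" using N3 by (auto simp: u_def)
    show ?thesis
    proof (rule realizable_cap[OF N(1) n(2,1) \<theta> p_def q_def top \<mu>_def a'(4) a(1) a'(1-3), of u])
      show "\<bar>a - \<mu> - u 1\<bar> < pi" "\<bar>pi - \<theta> (N - 1) - u (N - 1) + \<mu> - a\<bar> < pi"
        using w w' am am' t t' unfolding u1 t'_def[symmetric] abs_less_iff by auto
      show "\<bar>pi - \<theta> i - u i - u (Suc i)\<bar> < pi" if "0 < i" "i < N - 1" for i
      proof -
        have i: "0 < i" "i < N" "0 < Suc i" "Suc i < N" using that by auto
        show ?thesis unfolding abs_less_iff
          using u[OF i(1,2)] u[OF i(3,4)] by (intro conjI) linarith+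
      qed
      show "a - \<mu> - (p - q) < u 1" "a - \<mu> + (p - q) < pi - \<theta> (N - 1) - u (N - 1)"
        using w w' unfolding u1 by (auto simp: m1_def m2_def t'_def)
    qed (use u in auto)
  qed
qed

text \<open>The partner of vertex 0 under the cap has angle \<open>q = pi\<close>. The bounds on
  \<open>a\<close> then leave only \<open>\<theta> 0 / 2\<close>, and both chains are vertical at
  the partner. Positivity of \<open>\<theta> 0\<close> keeps the chord of the cap from being
  vertical.\<close>

lemma realizable_one_nonflat:
  assumes n: "n \<ge> 3" and x: "0 < \<theta> 0" "\<theta> 0 \<le> pi" and flat: "\<And>i. 0 < i \<Longrightarrow> i < n \<Longrightarrow> \<theta> i = pi"
  shows "realizable n \<theta>"
proof -
  have \<theta>: "\<And>i. i < n \<Longrightarrow> 0 \<le> \<theta> i \<and> \<theta> i \<le> pi" using x flat by (metis less_imp_le order_refl pi_ge_zero neq0_conv)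
  have f: "\<theta> 1 = pi" "\<theta> 2 = pi" using flat n by auto
  show ?thesis
    by (rule realizable_cap[where N = 2 and M = "n - 2" and a = "\<theta> 0 / 2" and u = "\<lambda>_. (pi - \<theta> 0)/2", OF _ _ _ \<theta> refl refl flat refl])
      (use n x f pi_gt_zero in \<open>auto simp: field_simps abs_if less_Suc_eq numeral_2_eq_2\<close>)
qed

section \<open>Figures made of semicircles\<close>

lemma arc_prof_semicircle:
  assumes "\<epsilon> = 1 \<or> \<epsilon> = - 1" "0 \<le> \<xi>" "\<xi> \<le> 1"
  shows "arc_prof (\<epsilon> * (pi/2)) (- (\<epsilon> * (pi/2))) \<xi> = \<epsilon> * sqrt (\<xi> * (1 - \<xi>))"
proof -
  have s: "sin (\<epsilon> * (pi/2)) = \<epsilon>" "cos (\<epsilon> * (pi/2)) = 0" using assms(1) by auto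
  have d: "arc_dir (\<epsilon> * (pi/2)) (- (\<epsilon> * (pi/2))) \<xi> = arcsin (\<epsilon> * (1 - 2 * \<xi>))"
    unfolding arc_dir_def sin_minus s by (simp add: algebra_simps)
  have "cos (arcsin (\<epsilon> * (1 - 2 * \<xi>))) = sqrt (1 - (\<epsilon> * (1 - 2 * \<xi>))\<^sup>2)"
    using assms by (intro cos_arcsin) auto
  also have "1 - (\<epsilon> * (1 - 2 * \<xi>))\<^sup>2 = 2\<^sup>2 * (\<xi> * (1 - \<xi>))"
    using assms(1) by (auto simp: power2_eq_square algebra_simps)
  also have "sqrt \<dots> = 2 * sqrt (\<xi> * (1 - \<xi>))" by (simp add: real_sqrt_mult)
  finally show ?thesis using assms(1) s unfolding arc_prof_def d by auto
qed

text \<open>The height of a semicircle over a point of its diameter is the geometric mean of the two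
  segments; \<epsilon> is 1 for the upper and -1 for the lower half.\<close>

lemma arc_fun_semicircle:
  assumes "\<epsilon> = 1 \<or> \<epsilon> = - 1" "x0 < x1" "x0 \<le> t" "t \<le> x1"
  shows "arc_fun x0 x1 y0 (\<epsilon> * (pi/2)) (- (\<epsilon> * (pi/2))) t = y0 + \<epsilon> * sqrt ((t - x0) * (x1 - t))"
proof -
  define \<xi> where "\<xi> = (t - x0) / (x1 - x0)"
  have \<xi>: "0 \<le> \<xi>" "\<xi> \<le> 1" using assms by (auto simp: \<xi>_def)
  have "t - x0 = (x1 - x0) * \<xi>" "x1 - t = (x1 - x0) * (1 - \<xi>)"
    using assms by (auto simp: \<xi>_def field_simps)
  then have "(t - x0) * (x1 - t) = (x1 - x0)\<^sup>2 * (\<xi> * (1 - \<xi>))" by (simp add: power2_eq_square)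
  then have "sqrt ((t - x0) * (x1 - t)) = (x1 - x0) * sqrt (\<xi> * (1 - \<xi>))"
    using assms by (simp add: real_sqrt_mult)
  then show ?thesis
    unfolding arc_fun_def \<xi>_def[symmetric] arc_prof_semicircle[OF assms(1) \<xi>] by simp
qed

lemma good_dirs_semicircle:
  "\<epsilon> = 1 \<or> \<epsilon> = - 1 \<Longrightarrow> good_dirs (\<epsilon> * (pi/2)) (- (\<epsilon> * (pi/2)))"
  using pi_gt_zero by (auto simp: good_dirs_def)

text \<open>Start directions of two consecutive semicircles of opposite bending. Each ends in the
  negative of its start direction, so the curve passes the middle node with a continuous vertical
  tangent and angle \<pi>.\<close>

definition zigzag :: "real \<Rightarrow> nat \<Rightarrow> real" where
  "zigzag \<epsilon> i = (if i = 0 then \<epsilon> else - \<epsilon>) * (pi/2)"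

lemma two_semicircles:
  assumes \<epsilon>: "\<epsilon> = 1 \<or> \<epsilon> = - 1" and x: "x 0 = (0::real)" "0 < x 1" "x 1 < x 2"
  shows "\<exists>h. arc_chain 2 x (zigzag \<epsilon>) (\<lambda>i. - zigzag \<epsilon> i) h \<and>
    (\<forall>t. 0 \<le> t \<and> t \<le> x 1 \<longrightarrow> h t = \<epsilon> * sqrt (t * (x 1 - t))) \<and>
    (\<forall>t. x 1 \<le> t \<and> t \<le> x 2 \<longrightarrow> h t = - \<epsilon> * sqrt ((t - x 1) * (x 2 - t)))"
proof -
  have \<epsilon>': "- \<epsilon> = 1 \<or> - \<epsilon> = - 1" using \<epsilon> by auto
  have "x i < x (Suc i)" if "i < 2" for i using that x by (cases "i = 0") (auto simp: less_Suc_eq numeral_2_eq_2)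
  moreover have "good_dirs (zigzag \<epsilon> i) (- zigzag \<epsilon> i)" for i
    using good_dirs_semicircle[OF \<epsilon>] good_dirs_semicircle[OF \<epsilon>'] by (auto simp: zigzag_def)
  ultimately obtain h where h: "arc_chain 2 x (zigzag \<epsilon>) (\<lambda>i. - zigzag \<epsilon> i) h" "h (x 0) = 0"
    using arc_chain_exists[of 2 x "zigzag \<epsilon>" "\<lambda>i. - zigzag \<epsilon> i" 0] by auto
  have 1: "h t = \<epsilon> * sqrt (t * (x 1 - t))" if "0 \<le> t" "t \<le> x 1" for t
  proof -
    have "h t = arc_fun (x 0) (x 1) (h (x 0)) (\<epsilon> * (pi/2)) (- (\<epsilon> * (pi/2))) t"
      using arc_chainD(3)[OF h(1), of 0 t] that x by (simp add: zigzag_def)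
    then show ?thesis using arc_fun_semicircle[OF \<epsilon>, of 0 "x 1" t 0] that x h(2) by simp
  qed
  have x1: "h (x 1) = 0" using 1[of "x 1"] x by simp
  have 2: "h t = - \<epsilon> * sqrt ((t - x 1) * (x 2 - t))" if "x 1 \<le> t" "t \<le> x 2" for t
  proof -
    have "h t = arc_fun (x 1) (x 2) (h (x 1)) (- \<epsilon> * (pi/2)) (- (- \<epsilon> * (pi/2))) t"
      using arc_chainD(3)[OF h(1), of 1 t] that x by (simp add: zigzag_def numeral_2_eq_2)
    then show ?thesis using arc_fun_semicircle[OF \<epsilon>', of "x 1" "x 2" t 0] that x x1 by simp
  qed
  show ?thesis using h 1 2 by blast
qed

text \<open>Yin-yang: below a large semicircle, a small semicircle arched upwards and one arched downwards.\<close>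

lemma realizable_teardrop:
  assumes n: "n \<ge> 3" and \<theta>: "\<theta> 0 = 0" "\<And>i. 0 < i \<Longrightarrow> i < n \<Longrightarrow> \<theta> i = pi"
  shows "realizable n \<theta>"
proof -
  define x :: "nat \<Rightarrow> real" where "x i = real i" for i
  obtain h where h: "arc_chain 2 x (zigzag 1) (\<lambda>i. - zigzag 1 i) h"
    "\<And>t. 0 \<le> t \<Longrightarrow> t \<le> 1 \<Longrightarrow> h t = sqrt (t * (1 - t))"
    "\<And>t. 1 \<le> t \<Longrightarrow> t \<le> 2 \<Longrightarrow> h t = - sqrt ((t - 1) * (2 - t))"
    using two_semicircles[of 1 x] by (auto simp: x_def)
  define M where "M = n - 2"
  have M: "M \<ge> 1" "n = 2 + M" using n by (auto simp: M_def)
  have g: "good_dirs (pi/2) (- (pi/2))" using good_dirs_semicircle[of 1] by simp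
  define H where "H = arc_fun 0 2 0 (pi/2) (- (pi/2))"
  have H: "H t = sqrt (t * (2 - t))" if "0 \<le> t" "t \<le> 2" for t
    using arc_fun_semicircle[of 1 0 2 t 0] that by (simp add: H_def)
  have top: "arc_chain M (\<lambda>k. real k * 2 / real M) (\<lambda>k. arc_dir (pi/2) (- (pi/2)) (real k / real M))
    (\<lambda>k. arc_dir (pi/2) (- (pi/2)) (real (Suc k) / real M)) H"
    unfolding H_def by (rule arc_chain_subdivide[OF g _ M(1)]) simp
  show ?thesis unfolding realizable_def
  proof (rule two_chain_polygon[OF h(1) top])
    \<comment> \<open>Both graphs leave the origin vertically upwards, which makes the cusp. Left of
      1 the radicands share the factor \<open>t\<close>; right of 1 the signs differ.\<close>
    show "h t < H t" if "x 0 < t" "t < x 2" for t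
    proof (cases "t \<le> 1")
      case True
      have "t * (1 - t) < t * (2 - t)" using that by (simp add: x_def)
      then show ?thesis using h(2)[of t] H[of t] that True by (simp add: x_def)
    next
      case False
      have "0 < t * (2 - t)" using that by (simp add: x_def)
      moreover have "0 \<le> (t - 1) * (2 - t)" using that False by (simp add: x_def)
      ultimately have "h t \<le> 0" "0 < H t" using h(3)[of t] H[of t] that False by (auto simp: x_def)
      then show ?thesis by linarith
    qed
    show "\<theta> i = pi + - zigzag 1 (i - 1) - zigzag 1 i" if "0 < i" "i < 2" for i
      using that \<theta>(2)[of i] n by (auto simp: zigzag_def)
    show "\<theta> (n - k) = pi + arc_dir (pi / 2) (- (pi / 2)) (real k / real M) -
         arc_dir (pi / 2) (- (pi / 2)) (real (Suc (k - 1)) / real M)" if "0 < k" "k < M" for k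
      using \<theta>(2)[of "n - k"] that M by simp
  qed (use M n \<theta> h H g in \<open>auto simp: x_def zigzag_def\<close>)
qed

text \<open>Both chains consist of a semicircle arched downwards followed by one arched upwards; the upper
  chain changes over earlier.\<close>

lemma realizable_alternating:
  assumes \<theta>: "\<theta> 0 = 0" "\<theta> 1 = pi" "\<theta> 2 = 0" "\<theta> 3 = pi"
  shows "realizable 4 \<theta>"
proof -
  define x :: "nat \<Rightarrow> real" where "x i = (if i = 0 then 0 else if i = 1 then 3 else 4)" for i
  define X :: "nat \<Rightarrow> real" where "X i = (if i = 0 then 0 else if i = 1 then 1 else 4)" for i
  obtain h where h: "arc_chain 2 x (zigzag (-1)) (\<lambda>i. - zigzag (-1) i) h"
    "\<And>t. 0 \<le> t \<Longrightarrow> t \<le> 3 \<Longrightarrow> h t = - sqrt (t * (3 - t))"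
    "\<And>t. 3 \<le> t \<Longrightarrow> t \<le> 4 \<Longrightarrow> h t = sqrt ((t - 3) * (4 - t))"
    using two_semicircles[of "-1" x] by (auto simp: x_def)
  obtain H where H: "arc_chain 2 X (zigzag (-1)) (\<lambda>i. - zigzag (-1) i) H"
    "\<And>t. 0 \<le> t \<Longrightarrow> t \<le> 1 \<Longrightarrow> H t = - sqrt (t * (1 - t))"
    "\<And>t. 1 \<le> t \<Longrightarrow> t \<le> 4 \<Longrightarrow> H t = sqrt ((t - 1) * (4 - t))"
    using two_semicircles[of "-1" X] by (auto simp: X_def)
  show ?thesis unfolding realizable_def
  proof (rule two_chain_polygon[OF h(1) H(1)])
    \<comment> \<open>Near each end the radicands share a factor, \<open>t\<close> or
      \<open>4 - t\<close>; between 1 and 3 the signs differ. At each end both tangents point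
      vertically downwards, hence two cusps.\<close>
    show "h t < H t" if t: "x 0 < t" "t < x 2" for t
    proof -
      have t: "0 < t" "t < 4" using t by (auto simp: x_def)
      consider "t \<le> 1" | "1 < t" "t < 3" | "3 \<le> t" by linarith
      then show ?thesis
      proof cases
        case 1
        have "t * (1 - t) < t * (3 - t)" using t by simp
        then show ?thesis using h(2)[of t] H(2)[of t] t 1 by simp
      next
        case 2
        have "0 < t * (3 - t)" "0 < (t - 1) * (4 - t)" using t 2 by auto
        then have "h t < 0" "0 < H t" using h(2)[of t] H(3)[of t] t 2 by auto
        then show ?thesis by linarith
      next
        case 3
        have "(t - 3) * (4 - t) < (t - 1) * (4 - t)" using t by simp
        then show ?thesis using h(3)[of t] H(3)[of t] t 3 by simp
      qed
    qed
    show "\<theta> i = pi + - zigzag (-1) (i - 1) - zigzag (-1) i" if "0 < i" "i < 2" for i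
    proof -
      have "i = 1" using that by simp
      then show ?thesis using \<theta> by (simp add: zigzag_def)
    qed
    show "\<theta> (4 - k) = pi + zigzag (-1) k - - zigzag (-1) (k - 1)" if "0 < k" "k < 2" for k
    proof -
      have "k = 1" using that by simp
      then show ?thesis using \<theta> by (simp add: zigzag_def)
    qed
  qed (use \<theta> h H in \<open>auto simp: x_def X_def zigzag_def\<close>)
qed


section \<open>Choice of the starting vertex\<close>

definition exceptional :: "nat \<Rightarrow> (nat \<Rightarrow> real) \<Rightarrow> bool" where
  "exceptional n \<theta> \<longleftrightarrow> n = 3 \<and> mset (map \<theta> [0..<n]) = {#0, 0, pi#}"

lemma exceptional_rotate:
  assumes "exceptional n (\<lambda>i. \<theta> ((i + k) mod n))"
  shows "exceptional n \<theta>"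
proof -
  have n: "n = 3" using assms by (simp add: exceptional_def)
  have u: "[0..<3] = [0, 1, 2::nat]" by (simp add: eval_nat_numeral)
  have "k mod 3 = 0 \<or> k mod 3 = 1 \<or> k mod 3 = 2" by linarith
  moreover have "(i + k) mod 3 = (i + k mod 3) mod 3" for i by (simp add: mod_simps)
  ultimately show ?thesis using assms unfolding exceptional_def n
    by (auto simp: u add_mset_commute numeral_2_eq_2)
qed

lemma exceptionalI:
  assumes "n = 3" "\<theta> 0 = 0" "\<theta> 1 = pi" "\<theta> 2 = 0"
  shows "exceptional n \<theta>"
proof -
  have u: "[0..<3] = [0, 1, 2::nat]" by (simp add: eval_nat_numeral)
  show ?thesis using assms by (simp add: exceptional_def u add_mset_commute)
qed

text \<open>The last vertex \<open>j\<close> of angle below \<pi> is the natural right end of the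
  cap, as only angles \<pi> follow it. Rotations repair the cases where the lower chain from 0 to
  \<open>j\<close> is too short or obstructed.\<close>

lemma realizable_first_nonflat:
  assumes n: "n \<ge> 3" and \<theta>: "\<And>i. i < n \<Longrightarrow> 0 \<le> \<theta> i \<and> \<theta> i \<le> pi"
    and less: "\<theta> 0 < pi" and ex: "\<not> exceptional n \<theta>"
  shows "realizable n \<theta>"
proof -
  define j where "j = Max {i. i < n \<and> \<theta> i < pi}"
  have "j \<in> {i. i < n \<and> \<theta> i < pi}" unfolding j_def using less n by (intro Max_in) (auto intro!: exI[of _ 0])
  then have j: "j < n" "\<theta> j < pi" by auto
  have top: "\<theta> i = pi" if "j < i" "i < n" for i
  proof (rule ccontr)
    assume "\<theta> i \<noteq> pi"
    then have "i \<le> j" unfolding j_def using \<theta>[of i] that by (intro Max_ge) auto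
    then show False using that by simp
  qed
  consider "j = 0" | "j = 1" | "j \<ge> 2" "\<not> (j = 2 \<and> \<theta> 0 = 0 \<and> \<theta> 2 = 0 \<and> \<theta> 1 = pi)"
    | "j = 2" "\<theta> 0 = 0" "\<theta> 2 = 0" "\<theta> 1 = pi" by linarith
  then show ?thesis
  proof cases
    case 1
    show ?thesis
    proof (cases "\<theta> 0 = 0")
      case True
      then show ?thesis using realizable_teardrop[OF n] top 1 by simp
    next
      case False
      then show ?thesis using realizable_one_nonflat[OF n, of \<theta>] top 1 \<theta>[of 0] n by auto
    qed
  next
    case 2
    \<comment> \<open>Exchanging the roles of the two adjacent vertices puts all angles \<pi> on the
      lower chain and leaves a cap of one edge.\<close>
    define \<theta>' where "\<theta>' i = \<theta> ((i + 1) mod n)" for i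
    have last: "\<theta>' (n - 1) = \<theta> 0" using n by (simp add: \<theta>'_def)
    have ex': "\<not> exceptional n \<theta>'" using exceptional_rotate[of n \<theta> 1] ex unfolding \<theta>'_def by blast
    have "realizable n \<theta>'"
    proof (rule realizable_two_nonflat[of "n - 1"])
      show "\<theta>' 0 < pi" using j 2 n by (simp add: \<theta>'_def)
      show "\<not> (n - 1 = 2 \<and> \<theta>' 0 = 0 \<and> \<theta>' 2 = 0 \<and> \<theta>' 1 = pi)"
      proof
        assume "n - 1 = 2 \<and> \<theta>' 0 = 0 \<and> \<theta>' 2 = 0 \<and> \<theta>' 1 = pi"
        then have "exceptional n \<theta>'" by (intro exceptionalI) auto
        then show False using ex' by blast
      qed
      show "0 \<le> \<theta>' i \<and> \<theta>' i \<le> pi" if "i < n" for i unfolding \<theta>'_def by (rule \<theta>) (use n in auto)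
    qed (use n last less in auto)
    then show ?thesis
    proof (rule realizable_rotate[rotated, of _ _ _ "n - 1"])
      show "\<theta> i = \<theta>' ((i + (n - 1)) mod n)" if "i < n" for i
      proof -
        have "((i + (n - 1)) mod n + 1) mod n = (i + n) mod n" using n by (simp add: mod_simps)
        then show ?thesis using that by (simp add: \<theta>'_def)
      qed
    qed (use n in simp)
  next
    case 3
    then show ?thesis using realizable_two_nonflat[of j n \<theta>] j \<theta> less top by blast
  next
    case 4
    then have "n \<noteq> 3" using exceptionalI[of n \<theta>] ex by auto
    then consider "n = 4" | "n \<ge> 5" using n by linarith
    then show ?thesis
    proof cases
      case 1
      then show ?thesis using realizable_alternating[of \<theta>] 4 top[of 3] by simp
    next
      case n5: 2
      \<comment> \<open>The sequence is 0, \<pi>, 0 followed by at least two angles \<pi>. Starting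
        at the second 0 moves this run to the lower chain and leaves one angle \<pi> on the cap, so
        the new \<open>N\<close> is \<open>n - 2 \<ge> 3\<close>.\<close>
      define \<theta>' where "\<theta>' i = \<theta> ((i + 2) mod n)" for i
      have last: "\<theta>' (n - 2) = 0" "\<theta>' (n - 1) = pi"
      proof -
        have "n - 2 + 2 = n" using n5 by simp
        then show "\<theta>' (n - 2) = 0" using 4 by (simp add: \<theta>'_def)
        have "(n - 1 + 2) mod n = (1 + n) mod n" using n5 by simp
        also have "\<dots> = 1" unfolding mod_add_self2 using n5 by simp
        finally show "\<theta>' (n - 1) = pi" using 4 by (simp add: \<theta>'_def)
      qed
      have "realizable n \<theta>'"
      proof (rule realizable_two_nonflat[of "n - 2"])
        have "(0 + 2) mod n = 2" using n5 by simp
        then show "\<theta>' 0 < pi" unfolding \<theta>'_def using 4 pi_gt_zero by presburger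
        show "\<theta>' i = pi" if "n - 2 < i" "i < n" for i
        proof -
          have "i = n - 1" using that by linarith
          then show ?thesis using last by simp
        qed
        show "0 \<le> \<theta>' i \<and> \<theta>' i \<le> pi" if "i < n" for i unfolding \<theta>'_def by (rule \<theta>) (use n in auto)
      qed (use n5 last in auto)
      then show ?thesis
      proof (rule realizable_rotate[rotated, of _ _ _ "n - 2"])
        show "\<theta> i = \<theta>' ((i + (n - 2)) mod n)" if "i < n" for i
        proof -
          have "i + (n - 2) + 2 = i + n" using n5 by simp
          then have "((i + (n - 2)) mod n + 2) mod n = (i + n) mod n" by (metis mod_add_left_eq)
          then show ?thesis using that by (simp add: \<theta>'_def)
        qed
      qed (use n in simp)
    qed
  qed
qed

theorem mainTheorem8:
  fixes n :: nat and \<theta> :: "nat \<Rightarrow> real"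
  assumes "n \<ge> 3"
    and "\<forall>i<n. 0 \<le> \<theta> i \<and> \<theta> i \<le> pi"
    and "\<not> (n = 3 \<and> mset (map \<theta> [0..<n]) = {#0, 0, pi#})"
  shows "\<exists>v g. simple_arc_polygon n v g \<and> (\<forall>i<n. interior_angle n v g i = \<theta> i)"
proof -
  have ex: "\<not> exceptional n \<theta>" using assms(3) by (simp add: exceptional_def)
  have "realizable n \<theta>"
  proof (cases "\<exists>k<n. \<theta> k < pi")
    case False
    \<comment> \<open>When all angles are \<pi>, the case of one distinguished vertex applies, since
      it admits the value \<pi> there too.\<close>
    then have "\<theta> i = pi" if "i < n" for i using assms(2) that by force
    then show ?thesis using realizable_one_nonflat[OF assms(1), of \<theta>] assms(1) by auto
  next
    case True
    then obtain k where k: "k < n" "\<theta> k < pi" by blast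
    define \<theta>' where "\<theta>' i = \<theta> ((i + k) mod n)" for i
    have "realizable n \<theta>'"
    proof (rule realizable_first_nonflat[OF assms(1)])
      show "0 \<le> \<theta>' i \<and> \<theta>' i \<le> pi" if "i < n" for i
        using assms(1,2) by (simp add: \<theta>'_def)
      show "\<not> exceptional n \<theta>'" using exceptional_rotate[of n \<theta> k] ex unfolding \<theta>'_def by blast
    qed (use k in \<open>simp add: \<theta>'_def\<close>)
    then show ?thesis
    proof (rule realizable_rotate[rotated, of _ _ _ "n - k"])
      show "\<theta> i = \<theta>' ((i + (n - k)) mod n)" if "i < n" for i
      proof -
        have "i + (n - k) + k = i + n" using k by simp
        then have "((i + (n - k)) mod n + k) mod n = (i + n) mod n" by (metis mod_add_left_eq)
        then show ?thesis using that by (simp add: \<theta>'_def)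
      qed
    qed (use assms(1) in simp)
  qed
  then show ?thesis by (simp add: realizable_def)
qed


end
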